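(* Let $1<p<\infty$, let $X$ be a Banach space and let $K$ be a bounded subset of $X^{*}$. The following are equivalent: (1) $K$ is weakly $p$-limited; (2) for all Banach spaces $Y\in W_{p}$ and every operator $T$ from $Y$ into $X$, the set $T^{*}(K)$ is relatively norm compact; (3) for every operator $T$ from $l_{p^{*}}$ into $X$, the set $T^{*}(K)$ is relatively norm compact.
   Context: Banach spaces are real or complex; an operator is a continuous linear map; $p^{*}$ is the conjugate exponent of $p$. A sequence $(x_n)_n$ in $X$ is weakly $p$-summable, written $(x_n)_n\in l_p^w(X)$, if $\sup\{(\sum_{n=1}^{\infty}|\langle x^*,x_n\rangle|^p)^{1/p}:x^*\in B_{X^*}\}<\infty$, where $B_{X^*}$ is the closed unit ball of $X^*$. A sequence $(x_n)_n$ is weakly $p$-convergent if $(x_n-x)_n$ is weakly $p$-summable for some $x\in X$. A Banach space $Y$ belongs to $W_p$ if every bounded sequence in $Y$ has a weakly $p$-convergent subsequence. A bounded subset $K$ of $X^*$ is weakly $p$-limited if $\lim_{n\to\infty}\sup_{x^*\in K}|\langle x^*,x_n\rangle|=0$ for every $(x_n)_n\in l_p^w(X)$. *)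

theory Defs
  imports "HOL-Analysis.Analysis" "HOL-Algebra.Module" "HOL-Library.Equipollence"
begin

text \<open>
  Banach spaces are carrier-based structures, since the theorem quantifies over Banach spaces inside
  one of the equivalent conditions, which type classes do not allow. They are modules in the sense
  of HOL-Algebra over the scalar field, together with a norm. The type of scalars is only ever
  instantiated to \<open>real\<close> and \<open>complex\<close>; the theorem has one conjunct for each.

  The carriers of the spaces \<open>Y\<close> quantified over inside the theorem live in a type
  \<open>'y\<close>, which plays the role of a universe: it may be any type with at least the
  cardinality of the continuum (so that it has room for a copy of the sequence spaces), hence
  can be chosen large enough for every Banach space given beforehand.
\<close>

definition scalars :: "'k::real_normed_field ring" where
  "scalars = \<lparr>carrier = UNIV, monoid.mult = (*), one = 1, zero = 0, add = (+)\<rparr>"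

record ('k, 'v) normed_module = "('k, 'v) module" +
  vnorm :: "'v \<Rightarrow> real"

text \<open>
  The locale \<^locale>\<open>Metric_space\<close> requires nonnegativity and symmetry of the distance also off
  the carrier, hence the value 0 there.
\<close>

definition vdist :: "('k, 'v) normed_module \<Rightarrow> 'v \<Rightarrow> 'v \<Rightarrow> real" where
  "vdist V x y =
     (if x \<in> carrier V \<and> y \<in> carrier V then vnorm V (x \<ominus>\<^bsub>V\<^esub> y) else 0)"

definition norm_topology :: "('k, 'v) normed_module \<Rightarrow> 'v topology" where
  "norm_topology V = Metric_space.mtopology (carrier V) (vdist V)"

definition norm_bounded :: "('k, 'v) normed_module \<Rightarrow> 'v set \<Rightarrow> bool" where
  "norm_bounded V S \<longleftrightarrow> Metric_space.mbounded (carrier V) (vdist V) S"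

definition relatively_compact :: "('k, 'v) normed_module \<Rightarrow> 'v set \<Rightarrow> bool" where
  "relatively_compact V S \<longleftrightarrow>
     S \<subseteq> carrier V \<and> compactin (norm_topology V) (norm_topology V closure_of S)"

definition normed_space :: "('k::real_normed_field, 'v) normed_module \<Rightarrow> bool" where
  "normed_space V \<longleftrightarrow>
     Module.module scalars V \<and>
     (\<forall>x\<in>carrier V. 0 \<le> vnorm V x) \<and>
     (\<forall>x\<in>carrier V. vnorm V x = 0 \<longleftrightarrow> x = \<zero>\<^bsub>V\<^esub>) \<and>
     (\<forall>x\<in>carrier V. \<forall>y\<in>carrier V. vnorm V (x \<oplus>\<^bsub>V\<^esub> y) \<le> vnorm V x + vnorm V y) \<and>
     (\<forall>c. \<forall>x\<in>carrier V. vnorm V (c \<odot>\<^bsub>V\<^esub> x) = norm c * vnorm V x)"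

definition banach_space :: "('k::real_normed_field, 'v) normed_module \<Rightarrow> bool" where
  "banach_space V \<longleftrightarrow> normed_space V \<and> Metric_space.mcomplete (carrier V) (vdist V)"

text \<open>
  Operators are continuous linear maps. Only the values on the carrier of the domain matter.
\<close>

definition operator ::
  "('k::real_normed_field, 'v) normed_module \<Rightarrow> ('k, 'w) normed_module \<Rightarrow> ('v \<Rightarrow> 'w) \<Rightarrow> bool" where
  "operator V W T \<longleftrightarrow>
     continuous_map (norm_topology V) (norm_topology W) T \<and>
     T \<in> carrier V \<rightarrow> carrier W \<and>
     (\<forall>x\<in>carrier V. \<forall>y\<in>carrier V. T (x \<oplus>\<^bsub>V\<^esub> y) = T x \<oplus>\<^bsub>W\<^esub> T y) \<and>
     (\<forall>c. \<forall>x\<in>carrier V. T (c \<odot>\<^bsub>V\<^esub> x) = c \<odot>\<^bsub>W\<^esub> T x)"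

definition closed_unit_ball :: "('k, 'v) normed_module \<Rightarrow> 'v set" where
  "closed_unit_ball V = {x \<in> carrier V. vnorm V x \<le> 1}"

text \<open>
  Functionals are taken to be \<^const>\<open>extensional\<close>, i.e. \<^const>\<open>undefined\<close> off the
  carrier, so that functionals agreeing on the carrier are equal. The ring fields \<open>mult\<close> and
  \<open>one\<close> inherited by the module record carry no meaning.
\<close>

definition dual_space ::
  "('k::real_normed_field, 'v) normed_module \<Rightarrow> ('k, 'v \<Rightarrow> 'k) normed_module" where
  "dual_space V =
    \<lparr>carrier = {f \<in> extensional (carrier V).
       continuous_map (norm_topology V) euclidean f \<and>
       (\<forall>x\<in>carrier V. \<forall>y\<in>carrier V. f (x \<oplus>\<^bsub>V\<^esub> y) = f x + f y) \<and>
       (\<forall>c. \<forall>x\<in>carrier V. f (c \<odot>\<^bsub>V\<^esub> x) = c * f x)},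
     monoid.mult = undefined,
     one = undefined,
     zero = (\<lambda>x\<in>carrier V. 0),
     add = (\<lambda>f g. \<lambda>x\<in>carrier V. f x + g x),
     smult = (\<lambda>c f. \<lambda>x\<in>carrier V. c * f x),
     vnorm = (\<lambda>f. SUP x\<in>closed_unit_ball V. norm (f x))\<rparr>"

definition adjoint_map ::
  "('k, 'v) normed_module \<Rightarrow> ('v \<Rightarrow> 'w) \<Rightarrow> ('w \<Rightarrow> 'k) \<Rightarrow> ('v \<Rightarrow> 'k)" where
  "adjoint_map V T f = compose (carrier V) f T"

definition lp_space :: "real \<Rightarrow> ('k::real_normed_field, nat \<Rightarrow> 'k) normed_module" where
  "lp_space r =
    \<lparr>carrier = {a. summable (\<lambda>n. norm (a n) powr r)},
     monoid.mult = undefined,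
     one = undefined,
     zero = (\<lambda>n. 0),
     add = (\<lambda>a b n. a n + b n),
     smult = (\<lambda>c a n. c * a n),
     vnorm = (\<lambda>a. (\<Sum>n. norm (a n) powr r) powr (1 / r))\<rparr>"

definition weakly_p_summable ::
  "real \<Rightarrow> ('k::real_normed_field, 'v) normed_module \<Rightarrow> (nat \<Rightarrow> 'v) \<Rightarrow> bool" where
  "weakly_p_summable p V x \<longleftrightarrow>
     range x \<subseteq> carrier V \<and>
     (\<forall>f\<in>closed_unit_ball (dual_space V). summable (\<lambda>n. norm (f (x n)) powr p)) \<and>
     bdd_above ((\<lambda>f. (\<Sum>n. norm (f (x n)) powr p) powr (1 / p)) ` closed_unit_ball (dual_space V))"

definition weakly_p_convergent ::
  "real \<Rightarrow> ('k::real_normed_field, 'v) normed_module \<Rightarrow> (nat \<Rightarrow> 'v) \<Rightarrow> bool" where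
  "weakly_p_convergent p V x \<longleftrightarrow>
     range x \<subseteq> carrier V \<and> (\<exists>l\<in>carrier V. weakly_p_summable p V (\<lambda>n. x n \<ominus>\<^bsub>V\<^esub> l))"

definition W_class :: "real \<Rightarrow> ('k::real_normed_field, 'v) normed_module set" where
  "W_class p = {Y. banach_space Y \<and>
     (\<forall>y. range y \<subseteq> carrier Y \<and> norm_bounded Y (range y) \<longrightarrow>
        (\<exists>r. strict_mono r \<and> weakly_p_convergent p Y (y \<circ> (r :: nat \<Rightarrow> nat))))}"

text \<open>
  The supremum is taken in \<^typ>\<open>ennreal\<close>, so that it is 0 for empty \<open>K\<close>.
\<close>

definition weakly_p_limited ::
  "real \<Rightarrow> ('k::real_normed_field, 'v) normed_module \<Rightarrow> ('v \<Rightarrow> 'k) set \<Rightarrow> bool" where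
  "weakly_p_limited p V K \<longleftrightarrow>
     K \<subseteq> carrier (dual_space V) \<and> norm_bounded (dual_space V) K \<and>
     (\<forall>x. weakly_p_summable p V x \<longrightarrow>
        (\<lambda>n. SUP f\<in>K. ennreal (norm (f (x n)))) \<longlonglongrightarrow> 0)"

end

theory Submission
  imports Defs "HOL-Complex_Analysis.Great_Picard"
begin

text \<open>
  The link between the conditions is that weakly \<open>p\<close>-summable sequences in \<open>X\<close> are the same thing as
  operators from \<open>l\<^sub>q\<close> into \<open>X\<close>, where \<open>q\<close> is conjugate to \<open>p\<close>: an operator sends the unit vectors,
  which are weakly \<open>p\<close>-summable in \<open>l\<^sub>q\<close>, to such a sequence, and by Hoelder's inequality every such
  sequence \<open>x\<close> comes from the operator \<open>a \<mapsto> \<Sum>n. a\<^sub>n x\<^sub>n\<close> (\<open>operator_of_weakly_p_summable\<close>). The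
  series converges because norms in \<open>X\<close> can be computed by functionals, which is the Hahn-Banach
  theorem (\<open>real_Hahn_Banach\<close>).

  Suppose that \<open>T\<^sup>*(K)\<close> is relatively compact for the operator \<open>T\<close> of a given sequence. The unit
  vectors are bounded and weakly null, hence tend to zero uniformly on the finite nets of \<open>T\<^sup>*(K)\<close> and
  thus on all of it; this says that the sequence tends to zero uniformly on \<open>K\<close>
  (\<open>relatively_compact_adjoint_imp_uniform\<close>).

  Suppose conversely that \<open>K\<close> is weakly \<open>p\<close>-limited, and let \<open>T\<close> be an operator from a space \<open>Y\<close> in
  \<open>W\<^sub>p\<close>. Bounded sequences in \<open>Y\<close> have subsequences whose images under \<open>T\<close> are Cauchy uniformly
  on \<open>K\<close>. So the unit ball of \<open>Y\<close> has finite nets for the distance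
  \<open>sup {\<bar>f (T y) - f (T z)\<bar> | f. f \<in> K}\<close>, and by a symmetry of compactness in the two arguments of
  \<open>(f, y) \<mapsto> f (T y)\<close> the set \<open>T\<^sup>*(K)\<close> has finite nets in norm (\<open>transpose_finite_nets\<close>,
  \<open>weakly_p_limited_imp_relatively_compact\<close>).

  It remains that \<open>l\<^sub>q\<close> belongs to \<open>W\<^sub>p\<close> (\<open>lp_in_W_class\<close>), which is a gliding hump argument: a
  bounded coordinatewise null sequence in \<open>l\<^sub>q\<close> has a subsequence close to one with disjoint supports,
  and disjointly supported bounded sequences are weakly \<open>p\<close>-summable. Since the spaces \<open>Y\<close> have vectors
  of a fixed type, \<open>l\<^sub>q\<close> enters there through an isometric copy, for which there is room because
  scalar sequences have the cardinality of the continuum.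
\<close>

section \<open>Normed spaces, operators and functionals\<close>

lemma cring_scalars: "cring (scalars :: 'k::real_normed_field ring)"
  by (rule cringI, rule abelian_groupI, rule_tac [7] comm_monoidI)
    (auto simp: scalars_def algebra_simps intro: exI[of _ "- x" for x])

lemma scalars_simps [simp]:
  "carrier scalars = UNIV" "monoid.mult scalars = (*)" "monoid.one scalars = 1"
  "ring.zero scalars = 0" "ring.add scalars = (+)"
  by (simp_all add: scalars_def)

lemma uminus_scalars [simp]: "\<ominus>\<^bsub>scalars\<^esub> (c :: 'k::real_normed_field) = - c"
proof -
  interpret cring "scalars :: 'k ring" by (rule cring_scalars)
  show ?thesis
    by (rule minus_equality) auto
qed

locale nspace =
  fixes V :: "('k::real_normed_field, 'v) normed_module" (structure)
  assumes normed: "normed_space V"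

sublocale nspace \<subseteq> mod: Module.module scalars V
  using normed by (simp add: normed_space_def)

context nspace
begin

lemma norm_nonneg [simp]: "x \<in> carrier V \<Longrightarrow> 0 \<le> vnorm V x"
  and norm_eq_0 [simp]: "x \<in> carrier V \<Longrightarrow> vnorm V x = 0 \<longleftrightarrow> x = \<zero>"
  and norm_add: "x \<in> carrier V \<Longrightarrow> y \<in> carrier V \<Longrightarrow> vnorm V (x \<oplus> y) \<le> vnorm V x + vnorm V y"
  and norm_smult: "x \<in> carrier V \<Longrightarrow> vnorm V (c \<odot> x) = norm c * vnorm V x"
  using normed by (auto simp: normed_space_def)

lemma norm_zero [simp]: "vnorm V \<zero> = 0"
  by simp

lemma smult_in [simp, intro]: "x \<in> carrier V \<Longrightarrow> c \<odot> x \<in> carrier V"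
  by (rule mod.smult_closed) auto

lemma smult_add_left: "x \<in> carrier V \<Longrightarrow> (a + b) \<odot> x = a \<odot> x \<oplus> b \<odot> x"
  using mod.smult_l_distr[of a b x] by simp

lemma smult_add_right: "x \<in> carrier V \<Longrightarrow> y \<in> carrier V \<Longrightarrow> a \<odot> (x \<oplus> y) = a \<odot> x \<oplus> a \<odot> y"
  using mod.smult_r_distr[of a x y] by simp

lemma smult_smult: "x \<in> carrier V \<Longrightarrow> a \<odot> (b \<odot> x) = (a * b) \<odot> x"
  using mod.smult_assoc1[of a b x] by simp

lemma smult_one [simp]: "x \<in> carrier V \<Longrightarrow> 1 \<odot> x = x"
  using mod.smult_one[of x] by simp

lemma smult_zero_left [simp]: "x \<in> carrier V \<Longrightarrow> 0 \<odot> x = \<zero>"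
  using mod.smult_l_null[of x] by simp

lemma smult_zero_right [simp]: "c \<odot> \<zero> = \<zero>"
  using mod.smult_r_null[of c] by simp

lemma a_inv_eq_smult: "x \<in> carrier V \<Longrightarrow> \<ominus> x = (-1) \<odot> x"
  using mod.smult_l_minus[of 1 x] by simp

lemma minus_eq_smult: "x \<in> carrier V \<Longrightarrow> y \<in> carrier V \<Longrightarrow> x \<ominus> y = x \<oplus> (-1) \<odot> y"
  by (simp add: a_minus_def a_inv_eq_smult)

lemma norm_uminus: "x \<in> carrier V \<Longrightarrow> vnorm V (\<ominus> x) = vnorm V x"
  by (simp add: a_inv_eq_smult norm_smult)

lemma norm_diff_le: "x \<in> carrier V \<Longrightarrow> y \<in> carrier V \<Longrightarrow> vnorm V (x \<ominus> y) \<le> vnorm V x + vnorm V y"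
  using norm_add[of x "\<ominus> y"] by (simp add: a_minus_def norm_uminus)

lemma norm_diff_commute: "x \<in> carrier V \<Longrightarrow> y \<in> carrier V \<Longrightarrow> vnorm V (x \<ominus> y) = vnorm V (y \<ominus> x)"
  by (metis a_minus_def mod.M.add.inv_closed mod.M.add.inv_mult_group mod.M.minus_minus
      mod.M.minus_closed norm_uminus)

lemma add_diff_cancel: "x \<in> carrier V \<Longrightarrow> y \<in> carrier V \<Longrightarrow> (x \<ominus> y) \<oplus> y = x"
  by (simp add: a_minus_def mod.M.a_assoc mod.M.l_neg)

lemma diff_add_diff:
  "x \<in> carrier V \<Longrightarrow> y \<in> carrier V \<Longrightarrow> z \<in> carrier V \<Longrightarrow> (x \<ominus> y) \<oplus> (y \<ominus> z) = x \<ominus> z"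
  by (metis a_minus_def add_diff_cancel mod.M.add.inv_closed mod.M.add.m_assoc mod.M.minus_closed)

lemma norm_le_diff: "x \<in> carrier V \<Longrightarrow> y \<in> carrier V \<Longrightarrow> vnorm V x \<le> vnorm V (x \<ominus> y) + vnorm V y"
  by (metis add_diff_cancel mod.M.minus_closed norm_add)

end

sublocale nspace \<subseteq> met: Metric_space "carrier V" "vdist V"
proof
  fix x y z
  show "0 \<le> vdist V x y"
    by (simp add: vdist_def)
  show "vdist V x y = vdist V y x"
    by (simp add: vdist_def norm_diff_commute)
  show "vdist V x y = 0 \<longleftrightarrow> x = y" if "x \<in> carrier V" "y \<in> carrier V"
    using that add_diff_cancel[of x y]
    by (auto simp: vdist_def a_minus_def mod.M.r_neg)
  show "vdist V x z \<le> vdist V x y + vdist V y z"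
    if "x \<in> carrier V" "y \<in> carrier V" "z \<in> carrier V"
    using that norm_add[of "x \<ominus> y" "y \<ominus> z"] by (simp add: vdist_def diff_add_diff)
qed

lemma (in nspace) norm_bounded_iff:
  "norm_bounded V S \<longleftrightarrow> S \<subseteq> carrier V \<and> (\<exists>B. \<forall>x\<in>S. vnorm V x \<le> B)"
proof
  assume "norm_bounded V S"
  then obtain c B where S: "S \<subseteq> met.mcball c B"
    by (auto simp: norm_bounded_def met.mbounded_def)
  have "x \<in> carrier V \<and> vnorm V x \<le> B + vnorm V c" if "x \<in> S" for x
  proof -
    have "x \<in> carrier V" "c \<in> carrier V" "vdist V c x \<le> B"
      using S that by auto
    then show ?thesis
      using norm_le_diff[of x c] by (simp add: vdist_def norm_diff_commute)
  qed
  then show "S \<subseteq> carrier V \<and> (\<exists>B. \<forall>x\<in>S. vnorm V x \<le> B)"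
    by auto
next
  assume S: "S \<subseteq> carrier V \<and> (\<exists>B. \<forall>x\<in>S. vnorm V x \<le> B)"
  then obtain B where B: "\<And>x. x \<in> S \<Longrightarrow> vnorm V x \<le> B" by auto
  have "vdist V x y \<le> B + B" if "x \<in> S" "y \<in> S" for x y
    using norm_diff_le[of x y] B[OF that(1)] B[OF that(2)] S that by (auto simp: vdist_def)
  then show "norm_bounded V S"
    using S by (auto simp: norm_bounded_def met.mbounded_alt)
qed

definition linear_map ::
  "('k::real_normed_field, 'v) normed_module \<Rightarrow> ('k, 'w) normed_module \<Rightarrow> ('v \<Rightarrow> 'w) \<Rightarrow> bool" where
  "linear_map V W T \<longleftrightarrow>
     T \<in> carrier V \<rightarrow> carrier W \<and>
     (\<forall>x\<in>carrier V. \<forall>y\<in>carrier V. T (x \<oplus>\<^bsub>V\<^esub> y) = T x \<oplus>\<^bsub>W\<^esub> T y) \<and>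
     (\<forall>c. \<forall>x\<in>carrier V. T (c \<odot>\<^bsub>V\<^esub> x) = c \<odot>\<^bsub>W\<^esub> T x)"

lemma operator_linear: "operator V W T \<Longrightarrow> linear_map V W T"
  by (auto simp: operator_def linear_map_def)

lemma linear_map_in: "linear_map V W T \<Longrightarrow> x \<in> carrier V \<Longrightarrow> T x \<in> carrier W"
  and linear_map_add: "linear_map V W T \<Longrightarrow> x \<in> carrier V \<Longrightarrow> y \<in> carrier V \<Longrightarrow>
    T (x \<oplus>\<^bsub>V\<^esub> y) = T x \<oplus>\<^bsub>W\<^esub> T y"
  and linear_map_smult: "linear_map V W T \<Longrightarrow> x \<in> carrier V \<Longrightarrow> T (c \<odot>\<^bsub>V\<^esub> x) = c \<odot>\<^bsub>W\<^esub> T x"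
  by (auto simp: linear_map_def)

locale nspace_pair = V: nspace V + W: nspace W
  for V :: "('k::real_normed_field, 'v) normed_module" and W :: "('k, 'w) normed_module"
begin

lemma linear_map_diff:
  assumes "linear_map V W T" "x \<in> carrier V" "y \<in> carrier V"
  shows "T (x \<ominus>\<^bsub>V\<^esub> y) = T x \<ominus>\<^bsub>W\<^esub> T y"
  using assms
  by (simp add: V.minus_eq_smult W.minus_eq_smult linear_map_in linear_map_add linear_map_smult)

lemma linear_map_zero: "linear_map V W T \<Longrightarrow> T \<zero>\<^bsub>V\<^esub> = \<zero>\<^bsub>W\<^esub>"
  using linear_map_smult[of V W T "\<zero>\<^bsub>V\<^esub>" 0] by (simp add: linear_map_in)

text \<open>
  Homogeneity turns continuity at zero into a bound on the whole space: every vector can be rescaled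
  into the neighbourhood that continuity provides.
\<close>

lemma operator_iff:
  "operator V W T \<longleftrightarrow> linear_map V W T \<and> (\<exists>C. \<forall>x\<in>carrier V. vnorm W (T x) \<le> C * vnorm V x)"
proof (intro iffI conjI)
  assume op: "operator V W T"
  then show lin: "linear_map V W T"
    by (rule operator_linear)
  have "continuous_map V.met.mtopology W.met.mtopology T"
    using op by (simp add: operator_def norm_topology_def)
  then have "\<exists>\<delta>>0. \<forall>x. x \<in> carrier V \<and> vdist V \<zero>\<^bsub>V\<^esub> x < \<delta> \<longrightarrow> vdist W (T \<zero>\<^bsub>V\<^esub>) (T x) < 1"
    unfolding V.met.metric_continuous_map[OF W.met.Metric_space_axioms]
    by (metis V.mod.M.zero_closed zero_less_one)
  then obtain \<delta> where \<delta>: "\<delta> > 0"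
    "\<And>x. x \<in> carrier V \<Longrightarrow> vnorm V x < \<delta> \<Longrightarrow> vnorm W (T x) < 1"
    using lin
    by (auto simp: vdist_def linear_map_in linear_map_zero[OF lin] a_minus_def V.norm_uminus W.norm_uminus)
  have "vnorm W (T x) \<le> 2 / \<delta> * vnorm V x" if x: "x \<in> carrier V" for x
  proof (cases "x = \<zero>\<^bsub>V\<^esub>")
    case True
    then show ?thesis by (simp add: linear_map_zero[OF lin])
  next
    case False
    then have pos: "vnorm V x > 0"
      using V.norm_nonneg[OF x] V.norm_eq_0[OF x] by linarith
    define t where "t = \<delta> / (2 * vnorm V x)"
    have t: "t > 0" "t * vnorm V x < \<delta>"
      using pos \<delta>(1) by (auto simp: t_def field_simps)
    have "vnorm W (T (of_real t \<odot>\<^bsub>V\<^esub> x)) < 1"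
      using t x by (intro \<delta>) (auto simp: V.norm_smult)
    then have "t * vnorm W (T x) < 1"
      using t x lin by (simp add: linear_map_smult W.norm_smult linear_map_in)
    then show ?thesis
      using pos \<delta>(1) by (simp add: t_def field_simps)
  qed
  then show "\<exists>C. \<forall>x\<in>carrier V. vnorm W (T x) \<le> C * vnorm V x" by blast
next
  assume R: "linear_map V W T \<and> (\<exists>C. \<forall>x\<in>carrier V. vnorm W (T x) \<le> C * vnorm V x)"
  then obtain C0 where C0: "\<And>x. x \<in> carrier V \<Longrightarrow> vnorm W (T x) \<le> C0 * vnorm V x" by blast
  define C where "C = \<bar>C0\<bar> + 1"
  have C: "vnorm W (T x) \<le> C * vnorm V x" "C > 0" if "x \<in> carrier V" for x
    using C0[OF that] mult_right_mono[of C0 C, OF _ V.norm_nonneg[OF that]]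
    by (auto simp: C_def intro: order_trans)
  have lin: "linear_map V W T" using R by simp
  have "\<exists>\<delta>>0. \<forall>x. x \<in> carrier V \<and> vdist V a x < \<delta> \<longrightarrow> vdist W (T a) (T x) < \<epsilon>"
    if a: "a \<in> carrier V" and "\<epsilon> > 0" for a and \<epsilon> :: real
  proof (intro exI[of _ "\<epsilon> / C"] conjI allI impI)
    show "\<epsilon> / C > 0" using that C(2)[OF a] by simp
    fix x assume x: "x \<in> carrier V \<and> vdist V a x < \<epsilon> / C"
    then have "vdist W (T a) (T x) = vnorm W (T (a \<ominus>\<^bsub>V\<^esub> x))"
      using a lin by (simp add: vdist_def linear_map_in linear_map_diff)
    also have "\<dots> \<le> C * vdist V a x"
      using a x C by (simp add: vdist_def)
    also have "\<dots> < \<epsilon>"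
      using x C(2)[OF a] by (simp add: field_simps)
    finally show "vdist W (T a) (T x) < \<epsilon>" .
  qed
  then have "continuous_map V.met.mtopology W.met.mtopology T"
    unfolding V.met.metric_continuous_map[OF W.met.Metric_space_axioms]
    using lin by (auto simp: linear_map_in)
  then show "operator V W T"
    using lin by (simp add: operator_def linear_map_def norm_topology_def)
qed

end

text \<open>
  The scalar field as a one-dimensional normed space makes functionals into operators, so that
  facts about operators apply to them.
\<close>

definition scalar_space :: "('k::real_normed_field, 'k) normed_module" where
  "scalar_space = \<lparr>carrier = UNIV, monoid.mult = (*), one = 1, zero = 0, add = (+),
     smult = (*), vnorm = norm\<rparr>"

lemma scalar_space_simps [simp]:
  "carrier scalar_space = UNIV" "ring.zero scalar_space = 0" "ring.add scalar_space = (+)"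
  "smult scalar_space = (*)" "vnorm scalar_space = norm"
  by (simp_all add: scalar_space_def)

lemma nspace_scalar_space: "nspace scalar_space"
proof
  have "abelian_group (scalar_space :: ('k::real_normed_field, 'k) normed_module)"
    by (rule abelian_groupI) (auto simp: algebra_simps intro: exI[of _ "- x" for x])
  then have "Module.module scalars (scalar_space :: ('k::real_normed_field, 'k) normed_module)"
    by (intro moduleI cring_scalars) (auto simp: algebra_simps)
  then show "normed_space (scalar_space :: ('k::real_normed_field, 'k) normed_module)"
    by (auto simp: normed_space_def norm_triangle_ineq norm_mult)
qed

lemma minus_scalar_space [simp]: "x \<ominus>\<^bsub>scalar_space\<^esub> y = x - y"
proof -
  interpret nspace scalar_space by (rule nspace_scalar_space)
  show ?thesis by (simp add: minus_eq_smult)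
qed

lemma norm_topology_scalar_space:
  "norm_topology scalar_space = (euclidean :: 'k::real_normed_field topology)"
proof -
  have "vdist scalar_space = (dist :: 'k::real_normed_field \<Rightarrow> 'k \<Rightarrow> real)"
    by (auto simp: vdist_def dist_norm fun_eq_iff)
  then show ?thesis
    by (simp add: norm_topology_def)
qed

lemma dual_carrier_iff:
  "f \<in> carrier (dual_space V) \<longleftrightarrow> f \<in> extensional (carrier V) \<and> operator V scalar_space f"
  by (auto simp: dual_space_def operator_def norm_topology_scalar_space)

sublocale nspace \<subseteq> fnl: nspace_pair V scalar_space
  by (intro nspace_pair.intro nspace_scalar_space nspace_axioms)

context nspace
begin

lemma dual_carrier_iff':
  "f \<in> carrier (dual_space V) \<longleftrightarrow> f \<in> extensional (carrier V) \<and> linear_map V scalar_space f \<and>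
     (\<exists>C. \<forall>x\<in>carrier V. norm (f x) \<le> C * vnorm V x)"
  by (simp add: dual_carrier_iff fnl.operator_iff)

lemma dual_linear: "f \<in> carrier (dual_space V) \<Longrightarrow> linear_map V scalar_space f"
  by (simp add: dual_carrier_iff')

lemma dual_add: "f \<in> carrier (dual_space V) \<Longrightarrow> x \<in> carrier V \<Longrightarrow> y \<in> carrier V \<Longrightarrow> f (x \<oplus> y) = f x + f y"
  and dual_smult: "f \<in> carrier (dual_space V) \<Longrightarrow> x \<in> carrier V \<Longrightarrow> f (c \<odot> x) = c * f x"
  and dual_diff: "f \<in> carrier (dual_space V) \<Longrightarrow> x \<in> carrier V \<Longrightarrow> y \<in> carrier V \<Longrightarrow> f (x \<ominus> y) = f x - f y"
  and dual_zero: "f \<in> carrier (dual_space V) \<Longrightarrow> f \<zero> = 0"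
  using dual_linear[of f] fnl.linear_map_diff[of f x y] fnl.linear_map_zero[of f]
  by (auto simp: linear_map_def)

lemma bdd_above_dual:
  assumes "f \<in> carrier (dual_space V)"
  shows "bdd_above ((\<lambda>x. norm (f x)) ` closed_unit_ball V)"
proof -
  obtain C where C: "\<And>x. x \<in> carrier V \<Longrightarrow> norm (f x) \<le> C * vnorm V x"
    using assms by (auto simp: dual_carrier_iff')
  have "norm (f x) \<le> \<bar>C\<bar>" if "x \<in> carrier V" "vnorm V x \<le> 1" for x
  proof -
    have "C * vnorm V x \<le> \<bar>C\<bar> * 1"
      using that by (intro mult_mono) auto
    then show ?thesis using C[OF that(1)] by simp
  qed
  then show ?thesis by (auto simp: bdd_above_def closed_unit_ball_def)
qed

lemma vnorm_dual: "vnorm (dual_space V) f = (SUP x\<in>closed_unit_ball V. norm (f x))"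
  by (simp add: dual_space_def)

lemma zero_in_ball: "\<zero> \<in> closed_unit_ball V"
  by (simp add: closed_unit_ball_def)

lemma dual_norm_nonneg: "f \<in> carrier (dual_space V) \<Longrightarrow> 0 \<le> vnorm (dual_space V) f"
  unfolding vnorm_dual
  by (rule cSUP_upper2[OF bdd_above_dual zero_in_ball]) auto

lemma dual_norm_bound:
  assumes f: "f \<in> carrier (dual_space V)" and x: "x \<in> carrier V"
  shows "norm (f x) \<le> vnorm (dual_space V) f * vnorm V x"
proof (cases "x = \<zero>")
  case True
  then show ?thesis using f by (simp add: dual_zero)
next
  case False
  then have pos: "vnorm V x > 0"
    using norm_nonneg[OF x] norm_eq_0[OF x] by linarith
  have "norm (f (of_real (inverse (vnorm V x)) \<odot> x)) \<le> vnorm (dual_space V) f"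
    unfolding vnorm_dual using pos x
    by (intro cSUP_upper bdd_above_dual f) (use pos False in \<open>auto simp: closed_unit_ball_def norm_smult norm_inverse intro!: eq_refl\<close>)
  then show ?thesis
    using pos x f by (simp add: dual_smult norm_mult norm_inverse norm_divide field_simps)
qed

lemma dual_norm_le:
  assumes "0 \<le> C" "\<And>x. x \<in> closed_unit_ball V \<Longrightarrow> norm (f x) \<le> C"
  shows "vnorm (dual_space V) f \<le> C"
  unfolding vnorm_dual using zero_in_ball assms by (intro cSUP_least) auto

lemma dualI:
  assumes "f \<in> extensional (carrier V)" "linear_map V scalar_space f"
    "\<And>x. x \<in> carrier V \<Longrightarrow> norm (f x) \<le> C * vnorm V x" "0 \<le> C"
  shows "f \<in> carrier (dual_space V)" "vnorm (dual_space V) f \<le> C"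
proof -
  show "f \<in> carrier (dual_space V)"
    using assms by (auto simp: dual_carrier_iff')
  have "norm (f x) \<le> C" if "x \<in> closed_unit_ball V" for x
    using that assms(3)[of x] mult_left_mono[of "vnorm V x" 1 C] assms(4)
    by (auto simp: closed_unit_ball_def)
  then show "vnorm (dual_space V) f \<le> C"
    by (rule dual_norm_le[OF assms(4)])
qed

lemma dual_ball_iff:
  "f \<in> closed_unit_ball (dual_space V) \<longleftrightarrow> f \<in> extensional (carrier V) \<and> linear_map V scalar_space f \<and>
     (\<forall>x\<in>carrier V. norm (f x) \<le> vnorm V x)"
  (is "?L = ?R")
proof
  assume L: ?L
  then have f: "f \<in> carrier (dual_space V)" "vnorm (dual_space V) f \<le> 1"
    by (auto simp: closed_unit_ball_def)
  have "norm (f x) \<le> vnorm V x" if "x \<in> carrier V" for x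
    using dual_norm_bound[OF f(1) that] mult_right_mono[OF f(2) norm_nonneg[OF that]] by simp
  then show ?R using f(1) by (auto simp: dual_carrier_iff')
next
  assume ?R
  then show ?L
    using dualI[of f 1] by (auto simp: closed_unit_ball_def)
qed

lemma dual_simps [simp]:
  "ring.zero (dual_space V) = (\<lambda>x\<in>carrier V. 0)"
  "ring.add (dual_space V) = (\<lambda>f g. \<lambda>x\<in>carrier V. f x + g x)"
  "smult (dual_space V) = (\<lambda>c f. \<lambda>x\<in>carrier V. c * f x)"
  by (simp_all add: dual_space_def)

lemma dual_zero_closed: "(\<lambda>x\<in>carrier V. 0) \<in> carrier (dual_space V)"
  by (auto simp: dual_carrier_iff' linear_map_def intro!: exI[of _ 0])

lemma dual_add_closed:
  assumes f: "f \<in> carrier (dual_space V)" and g: "g \<in> carrier (dual_space V)"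
  shows "(\<lambda>x\<in>carrier V. f x + g x) \<in> carrier (dual_space V)"
    "vnorm (dual_space V) (\<lambda>x\<in>carrier V. f x + g x) \<le> vnorm (dual_space V) f + vnorm (dual_space V) g"
proof -
  have "linear_map V scalar_space (\<lambda>x\<in>carrier V. f x + g x)"
    using dual_linear[OF f] dual_linear[OF g] by (auto simp: linear_map_def algebra_simps)
  moreover have "norm (f x + g x) \<le> (vnorm (dual_space V) f + vnorm (dual_space V) g) * vnorm V x"
    if "x \<in> carrier V" for x
    using norm_triangle_ineq[of "f x" "g x"] dual_norm_bound[OF f that] dual_norm_bound[OF g that]
    by (simp add: algebra_simps)
  ultimately show "(\<lambda>x\<in>carrier V. f x + g x) \<in> carrier (dual_space V)"
    "vnorm (dual_space V) (\<lambda>x\<in>carrier V. f x + g x) \<le> vnorm (dual_space V) f + vnorm (dual_space V) g"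
    using dual_norm_nonneg[OF f] dual_norm_nonneg[OF g]
    by (intro dualI[where C = "vnorm (dual_space V) f + vnorm (dual_space V) g"]; simp)+
qed

lemma dual_smult_closed:
  assumes f: "f \<in> carrier (dual_space V)"
  shows "(\<lambda>x\<in>carrier V. c * f x) \<in> carrier (dual_space V)"
    "vnorm (dual_space V) (\<lambda>x\<in>carrier V. c * f x) \<le> norm c * vnorm (dual_space V) f"
proof -
  have "linear_map V scalar_space (\<lambda>x\<in>carrier V. c * f x)"
    using dual_linear[OF f] by (auto simp: linear_map_def algebra_simps)
  moreover have "norm (c * f x) \<le> (norm c * vnorm (dual_space V) f) * vnorm V x"
    if "x \<in> carrier V" for x
    using mult_left_mono[OF dual_norm_bound[OF f that], of "norm c"] by (simp add: norm_mult algebra_simps)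
  ultimately show "(\<lambda>x\<in>carrier V. c * f x) \<in> carrier (dual_space V)"
    "vnorm (dual_space V) (\<lambda>x\<in>carrier V. c * f x) \<le> norm c * vnorm (dual_space V) f"
    using dual_norm_nonneg[OF f]
    by (intro dualI[where C = "norm c * vnorm (dual_space V) f"]; simp)+
qed

lemma dual_eqI:
  assumes "f \<in> carrier (dual_space V)" "g \<in> carrier (dual_space V)"
    "\<And>x. x \<in> carrier V \<Longrightarrow> f x = g x"
  shows "f = g"
  using assms by (intro extensionalityI) (auto simp: dual_carrier_iff')

lemma nspace_dual: "nspace (dual_space V)"
proof
  have ext: "restrict f (carrier V) = f" if "f \<in> carrier (dual_space V)" for f
    using that by (simp add: dual_carrier_iff extensional_restrict)
  have "abelian_group (dual_space V)"
  proof (rule abelian_groupI)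
    fix f assume f: "f \<in> carrier (dual_space V)"
    show "\<exists>g\<in>carrier (dual_space V). g \<oplus>\<^bsub>dual_space V\<^esub> f = \<zero>\<^bsub>dual_space V\<^esub>"
      by (rule bexI[OF _ dual_smult_closed(1)[OF f, of "-1"]]) (auto intro: restrict_ext)
  qed (auto simp: dual_zero_closed dual_add_closed ext algebra_simps intro: restrict_ext cong: restrict_cong)
  then have "Module.module scalars (dual_space V)"
    by (intro moduleI cring_scalars)
      (auto simp: dual_smult_closed ext algebra_simps intro: restrict_ext cong: restrict_cong)
  moreover have "vnorm (dual_space V) f = 0 \<longleftrightarrow> f = \<zero>\<^bsub>dual_space V\<^esub>" if f: "f \<in> carrier (dual_space V)" for f
  proof
    assume "vnorm (dual_space V) f = 0"
    then show "f = \<zero>\<^bsub>dual_space V\<^esub>"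
      using dual_norm_bound[OF f] by (intro dual_eqI f) (auto simp: dual_zero_closed)
  next
    assume "f = \<zero>\<^bsub>dual_space V\<^esub>"
    then have "vnorm (dual_space V) f \<le> 0"
      by (intro dual_norm_le) (auto simp: closed_unit_ball_def)
    then show "vnorm (dual_space V) f = 0"
      using dual_norm_nonneg[OF f] by linarith
  qed
  moreover have "vnorm (dual_space V) (\<lambda>x\<in>carrier V. c * f x) = norm c * vnorm (dual_space V) f"
    if f: "f \<in> carrier (dual_space V)" for c f
  proof (cases "c = 0")
    case True
    have "vnorm (dual_space V) (\<lambda>x\<in>carrier V. c * f x) \<le> 0"
      using dual_smult_closed(2)[OF f, of c] True by simp
    then show ?thesis
      using dual_norm_nonneg[OF dual_smult_closed(1)[OF f, of c]] True by simp
  next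
    case False
    let ?g = "\<lambda>x\<in>carrier V. c * f x"
    have "vnorm (dual_space V) (\<lambda>x\<in>carrier V. inverse c * ?g x) \<le> norm (inverse c) * vnorm (dual_space V) ?g"
      by (rule dual_smult_closed(2)[OF dual_smult_closed(1)[OF f]])
    moreover have "(\<lambda>x\<in>carrier V. inverse c * ?g x) = f"
      by (subst ext[OF f, symmetric]) (use False in \<open>auto intro!: restrict_ext\<close>)
    ultimately have "vnorm (dual_space V) f \<le> inverse (norm c) * vnorm (dual_space V) ?g"
      by (simp only: norm_inverse)
    from mult_left_mono[OF this norm_ge_zero[of c]] False
    have "norm c * vnorm (dual_space V) f \<le> vnorm (dual_space V) ?g"
      by (simp add: mult.assoc[symmetric])
    then show ?thesis
      using dual_smult_closed(2)[OF f, of c] by simp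
  qed
  ultimately show "normed_space (dual_space V)"
    by (auto simp: normed_space_def dual_norm_nonneg dual_add_closed)
qed

end

lemma (in nspace) vdist_dual_bound:
  assumes "f \<in> carrier (dual_space V)" "g \<in> carrier (dual_space V)" "x \<in> carrier V"
  shows "norm (f x - g x) \<le> vdist (dual_space V) f g * vnorm V x"
proof -
  interpret dual: nspace "dual_space V" by (rule nspace_dual)
  have "(f \<ominus>\<^bsub>dual_space V\<^esub> g) x = f x - g x"
    using assms by (simp add: dual.minus_eq_smult)
  then show ?thesis
    using dual_norm_bound[of "f \<ominus>\<^bsub>dual_space V\<^esub> g" x] assms by (simp add: vdist_def)
qed

lemma (in nspace) vdist_dual_le:
  assumes "f \<in> carrier (dual_space V)" "g \<in> carrier (dual_space V)" "0 \<le> C"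
    "\<And>x. x \<in> closed_unit_ball V \<Longrightarrow> norm (f x - g x) \<le> C"
  shows "vdist (dual_space V) f g \<le> C"
proof -
  interpret dual: nspace "dual_space V" by (rule nspace_dual)
  have "(f \<ominus>\<^bsub>dual_space V\<^esub> g) x = f x - g x" if "x \<in> carrier V" for x
    using assms that by (simp add: dual.minus_eq_smult)
  then have "vnorm (dual_space V) (f \<ominus>\<^bsub>dual_space V\<^esub> g) \<le> C"
    using assms by (intro dual_norm_le) (auto simp: closed_unit_ball_def)
  then show ?thesis
    using assms by (simp add: vdist_def)
qed

text \<open>
  A Cauchy sequence of functionals converges uniformly on the unit ball to its pointwise limit,
  which is again linear, and is bounded because it is uniformly close to a bounded functional.
\<close>

lemma mcomplete_dual:
  fixes V :: "('k::{real_normed_field,complete_space}, 'v) normed_module"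
  assumes "nspace V"
  shows "Metric_space.mcomplete (carrier (dual_space V)) (vdist (dual_space V))"
proof -
  interpret nspace V by fact
  interpret dual: nspace "dual_space V" by (rule nspace_dual)
  show ?thesis
    unfolding dual.met.mcomplete_def
  proof (intro allI impI)
    fix \<sigma> assume MC: "dual.met.MCauchy \<sigma>"
    then have \<sigma>: "\<sigma> n \<in> carrier (dual_space V)" for n
      by (auto simp: dual.met.MCauchy_def)
    have cauchy: "\<exists>N. \<forall>n\<ge>N. \<forall>m\<ge>N. vdist (dual_space V) (\<sigma> n) (\<sigma> m) < e" if "e > 0" for e
      using MC that unfolding dual.met.MCauchy_def by meson
    have unif: "\<exists>N. \<forall>n\<ge>N. \<forall>m\<ge>N. \<forall>x\<in>carrier V. norm (\<sigma> n x - \<sigma> m x) \<le> e * vnorm V x"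
      if e: "e > 0" for e
    proof -
      obtain N where N: "\<And>n m. n \<ge> N \<Longrightarrow> m \<ge> N \<Longrightarrow> vdist (dual_space V) (\<sigma> n) (\<sigma> m) < e"
        using cauchy[OF e] by blast
      have "norm (\<sigma> n x - \<sigma> m x) \<le> e * vnorm V x" if "n \<ge> N" "m \<ge> N" "x \<in> carrier V" for n m x
        using vdist_dual_bound[OF \<sigma> \<sigma> that(3), of n m]
          mult_right_mono[OF less_imp_le[OF N[OF that(1,2)]] norm_nonneg[OF that(3)]] by linarith
      then show ?thesis by blast
    qed
    have "Cauchy (\<lambda>n. \<sigma> n x)" if x: "x \<in> carrier V" for x
    proof (rule metric_CauchyI)
      fix e :: real assume e: "e > 0"
      have pos: "vnorm V x + 1 > 0" using norm_nonneg[OF x] by linarith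
      obtain N where "\<And>n m. n \<ge> N \<Longrightarrow> m \<ge> N \<Longrightarrow> norm (\<sigma> n x - \<sigma> m x) \<le> e / (vnorm V x + 1) * vnorm V x"
        using unif[of "e / (vnorm V x + 1)"] e pos x by auto
      moreover have "e / (vnorm V x + 1) * vnorm V x < e"
        using e pos by (simp add: field_simps)
      ultimately show "\<exists>M. \<forall>m\<ge>M. \<forall>n\<ge>M. dist (\<sigma> m x) (\<sigma> n x) < e"
        unfolding dist_norm by (meson le_less_trans)
    qed
    then have lim: "(\<lambda>n. \<sigma> n x) \<longlonglongrightarrow> lim (\<lambda>n. \<sigma> n x)" if "x \<in> carrier V" for x
      using that by (simp add: Cauchy_convergent_iff convergent_LIMSEQ_iff)
    define f where "f = (\<lambda>x\<in>carrier V. lim (\<lambda>n. \<sigma> n x))"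
    have f: "(\<lambda>n. \<sigma> n x) \<longlonglongrightarrow> f x" if "x \<in> carrier V" for x
      using lim[OF that] that by (simp add: f_def)
    have linf: "linear_map V scalar_space f"
    proof -
      have "f (x \<oplus>\<^bsub>V\<^esub> y) = f x + f y" if "x \<in> carrier V" "y \<in> carrier V" for x y
        using LIMSEQ_unique[OF f[of "x \<oplus>\<^bsub>V\<^esub> y"], of "f x + f y"] tendsto_add[OF f[OF that(1)] f[OF that(2)]]
          that by (simp add: dual_add[OF \<sigma>])
      moreover have "f (c \<odot>\<^bsub>V\<^esub> x) = c * f x" if "x \<in> carrier V" for c x
        using LIMSEQ_unique[OF f[of "c \<odot>\<^bsub>V\<^esub> x"], of "c * f x"] tendsto_mult_left[OF f[OF that(1)], of c]
          that by (simp add: dual_smult[OF \<sigma>])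
      ultimately show ?thesis by (auto simp: linear_map_def)
    qed
    have close: "\<exists>N. \<forall>n\<ge>N. \<forall>x\<in>carrier V. norm (\<sigma> n x - f x) \<le> e * vnorm V x" if e: "e > 0" for e
    proof -
      obtain N where N: "\<And>n m x. n \<ge> N \<Longrightarrow> m \<ge> N \<Longrightarrow> x \<in> carrier V \<Longrightarrow> norm (\<sigma> n x - \<sigma> m x) \<le> e * vnorm V x"
        using unif[OF e] by blast
      have "norm (\<sigma> n x - f x) \<le> e * vnorm V x" if "n \<ge> N" "x \<in> carrier V" for n x
        using N that
        by (intro tendsto_upperbound[OF tendsto_norm[OF tendsto_diff[OF tendsto_const f[OF that(2)]]]])
          (auto simp: eventually_sequentially)
      then show ?thesis by blast
    qed
    have fd: "f \<in> carrier (dual_space V)"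
    proof -
      obtain N where N: "\<And>x. x \<in> carrier V \<Longrightarrow> norm (\<sigma> N x - f x) \<le> 1 * vnorm V x"
        using close[of 1] by auto
      have "norm (f x) \<le> (vnorm (dual_space V) (\<sigma> N) + 1) * vnorm V x" if "x \<in> carrier V" for x
        using norm_triangle_ineq2[of "f x" "\<sigma> N x"] N[OF that] dual_norm_bound[OF \<sigma>, of x N] that
        by (simp add: algebra_simps norm_minus_commute)
      then show ?thesis
        using linf by (auto simp: dual_carrier_iff' f_def)
    qed
    have "\<exists>N. \<forall>n\<ge>N. \<sigma> n \<in> carrier (dual_space V) \<and> vdist (dual_space V) (\<sigma> n) f < e" if e: "e > 0" for e
    proof -
      obtain N where N: "\<And>n x. n \<ge> N \<Longrightarrow> x \<in> carrier V \<Longrightarrow> norm (\<sigma> n x - f x) \<le> e/2 * vnorm V x"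
        using close[of "e/2"] e by auto
      have "norm (\<sigma> n x - f x) \<le> e/2" if "n \<ge> N" "x \<in> closed_unit_ball V" for n x
      proof -
        have "e/2 * vnorm V x \<le> e/2 * 1"
          using that e by (intro mult_left_mono) (auto simp: closed_unit_ball_def)
        then show ?thesis
          using N[OF that(1), of x] that(2) by (auto simp: closed_unit_ball_def)
      qed
      then have "vdist (dual_space V) (\<sigma> n) f \<le> e/2" if "n \<ge> N" for n
        using that e by (intro vdist_dual_le \<sigma> fd) auto
      then show ?thesis using e \<sigma> by (intro exI[of _ N]) force
    qed
    then show "\<exists>f. limitin dual.met.mtopology \<sigma> f sequentially"
      using fd by (auto simp: dual.met.limit_metric_sequentially)
  qed
qed

text \<open>
  Completeness of the dual space reduces compactness of closures to finite nets.
\<close>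

lemma relatively_compact_dual_iff:
  fixes V :: "('k::{real_normed_field,complete_space}, 'v) normed_module"
  assumes "nspace V"
  shows "relatively_compact (dual_space V) S \<longleftrightarrow>
    Metric_space.mtotally_bounded (carrier (dual_space V)) (vdist (dual_space V)) S"
proof -
  interpret dual: nspace "dual_space V" using assms by (rule nspace.nspace_dual)
  show ?thesis
    using dual.met.mtotally_bounded_eq_compact_closure_of[OF mcomplete_dual[OF assms]]
    by (simp add: relatively_compact_def norm_topology_def)
qed

section \<open>The Hahn-Banach theorem\<close>

definition sublinear :: "('k::real_normed_field, 'v) normed_module \<Rightarrow> ('v \<Rightarrow> real) \<Rightarrow> bool" where
  "sublinear V p \<longleftrightarrow>
     (\<forall>y\<in>carrier V. \<forall>z\<in>carrier V. p (y \<oplus>\<^bsub>V\<^esub> z) \<le> p y + p z) \<and>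
     (\<forall>t>0. \<forall>y\<in>carrier V. p (of_real t \<odot>\<^bsub>V\<^esub> y) \<le> t * p y)"

context nspace
begin

lemma sublinear_add: "sublinear V p \<Longrightarrow> y \<in> carrier V \<Longrightarrow> z \<in> carrier V \<Longrightarrow> p (y \<oplus> z) \<le> p y + p z"
  by (simp add: sublinear_def)

lemma sublinear_scale:
  assumes "sublinear V p" "y \<in> carrier V" "t > 0"
  shows "p (of_real t \<odot> y) = t * p y"
proof (rule antisym)
  show "p (of_real t \<odot> y) \<le> t * p y"
    using assms by (simp add: sublinear_def)
  have "p (of_real (inverse t) \<odot> (of_real t \<odot> y)) \<le> inverse t * p (of_real t \<odot> y)"
    using assms unfolding sublinear_def by (metis inverse_positive_iff_positive smult_in)
  moreover have "of_real (inverse t) \<odot> (of_real t \<odot> y) = y"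
    using assms by (simp add: smult_smult flip: of_real_mult)
  ultimately show "t * p y \<le> p (of_real t \<odot> y)"
    using assms by (simp add: field_simps)
qed

lemma sublinear_zero: "sublinear V p \<Longrightarrow> p \<zero> = 0"
  using sublinear_scale[of p \<zero> 2] by simp

lemma sublinear_uminus_ge: "sublinear V p \<Longrightarrow> y \<in> carrier V \<Longrightarrow> - p (\<ominus> y) \<le> p y"
  using sublinear_add[of p y "\<ominus> y"] by (simp add: mod.M.r_neg sublinear_zero)

lemma sublinear_norm: "sublinear V (vnorm V)"
  by (simp add: sublinear_def norm_add norm_smult)

text \<open>
  The largest sublinear functional below \<open>p\<close> whose value at \<open>- z\<close> is at most
  \<open>- p z\<close>.
\<close>

definition lowered :: "('v \<Rightarrow> real) \<Rightarrow> 'v \<Rightarrow> 'v \<Rightarrow> real" where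
  "lowered p z = (\<lambda>y. INF t\<in>{0..}. p (y \<oplus> of_real t \<odot> z) - t * p z)"

lemma lowered_bdd:
  assumes p: "sublinear V p" and z: "z \<in> carrier V" and y: "y \<in> carrier V"
  shows "bdd_below ((\<lambda>t. p (y \<oplus> of_real t \<odot> z) - t * p z) ` {0..})"
proof (rule bdd_belowI2)
  fix t :: real assume t: "t \<in> {0..}"
  have "t * p z = p (of_real t \<odot> z)"
    using sublinear_scale[OF p z, of t] sublinear_zero[OF p] t z by (cases "t = 0") auto
  also have "of_real t \<odot> z = (y \<oplus> of_real t \<odot> z) \<oplus> \<ominus> y"
    using y z by (simp add: mod.M.a_ac mod.M.r_neg2)
  also have "p \<dots> \<le> p (y \<oplus> of_real t \<odot> z) + p (\<ominus> y)"
    using y z by (intro sublinear_add p) auto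
  finally show "- p (\<ominus> y) \<le> p (y \<oplus> of_real t \<odot> z) - t * p z" by simp
qed

lemma lowered_le:
  assumes "sublinear V p" "z \<in> carrier V" "y \<in> carrier V" "0 \<le> t"
  shows "lowered p z y \<le> p (y \<oplus> of_real t \<odot> z) - t * p z"
  unfolding lowered_def using assms by (intro cINF_lower lowered_bdd) auto

lemma lowered_ge:
  assumes "\<And>t. 0 \<le> t \<Longrightarrow> c \<le> p (y \<oplus> of_real t \<odot> z) - t * p z"
  shows "c \<le> lowered p z y"
  unfolding lowered_def using assms by (intro cINF_greatest) auto

lemma lowered_le_self: "sublinear V p \<Longrightarrow> z \<in> carrier V \<Longrightarrow> y \<in> carrier V \<Longrightarrow> lowered p z y \<le> p y"
  using lowered_le[of p z y 0] by simp

lemma lowered_uminus: "sublinear V p \<Longrightarrow> z \<in> carrier V \<Longrightarrow> lowered p z (\<ominus> z) \<le> - p z"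
  using lowered_le[of p z "\<ominus> z" 1] by (simp add: mod.M.l_neg sublinear_zero)

lemma sublinear_lowered:
  assumes p: "sublinear V p" and z: "z \<in> carrier V"
  shows "sublinear V (lowered p z)"
  unfolding sublinear_def
proof (intro conjI ballI allI impI)
  fix x y assume x: "x \<in> carrier V" and y: "y \<in> carrier V"
  have key: "lowered p z (x \<oplus> y) \<le> (p (x \<oplus> of_real s \<odot> z) - s * p z) + (p (y \<oplus> of_real t \<odot> z) - t * p z)"
    if "0 \<le> s" "0 \<le> t" for s t
  proof -
    have "(x \<oplus> y) \<oplus> of_real (s + t) \<odot> z = (x \<oplus> of_real s \<odot> z) \<oplus> (y \<oplus> of_real t \<odot> z)"
      using x y z by (simp add: smult_add_left mod.M.a_ac)
    moreover have "p ((x \<oplus> of_real s \<odot> z) \<oplus> (y \<oplus> of_real t \<odot> z)) \<le> p (x \<oplus> of_real s \<odot> z) + p (y \<oplus> of_real t \<odot> z)"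
      using x y z by (intro sublinear_add p) auto
    ultimately show ?thesis
      using lowered_le[OF p z, of "x \<oplus> y" "s + t"] x y that by (simp add: algebra_simps)
  qed
  have "lowered p z (x \<oplus> y) - (p (y \<oplus> of_real t \<odot> z) - t * p z) \<le> lowered p z x" if "0 \<le> t" for t
    using key[OF _ that] by (intro lowered_ge) (simp add: algebra_simps)
  then have "lowered p z (x \<oplus> y) - lowered p z x \<le> lowered p z y"
    by (intro lowered_ge) (simp add: algebra_simps)
  then show "lowered p z (x \<oplus> y) \<le> lowered p z x + lowered p z y" by simp
next
  fix c :: real and y assume c: "c > 0" and y: "y \<in> carrier V"
  have "lowered p z (of_real c \<odot> y) / c \<le> lowered p z y"
  proof (rule lowered_ge)
    fix t :: real assume t: "0 \<le> t"
    have "of_real c \<odot> (y \<oplus> of_real t \<odot> z) = of_real c \<odot> y \<oplus> of_real (c * t) \<odot> z"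
      using y z by (simp add: smult_add_right smult_smult)
    then have "p (of_real c \<odot> y \<oplus> of_real (c * t) \<odot> z) = c * p (y \<oplus> of_real t \<odot> z)"
      using sublinear_scale[OF p _ c, of "y \<oplus> of_real t \<odot> z"] y z by simp
    then show "lowered p z (of_real c \<odot> y) / c \<le> p (y \<oplus> of_real t \<odot> z) - t * p z"
      using lowered_le[OF p z, of "of_real c \<odot> y" "c * t"] c t y by (simp add: field_simps)
  qed
  then show "lowered p z (of_real c \<odot> y) \<le> c * lowered p z y"
    using c by (simp add: field_simps)
qed

text \<open>
  A minimal sublinear functional agrees with all functionals obtained from it by lowering, hence
  is odd, hence additive.
\<close>

lemma minimal_sublinear:
  assumes p: "sublinear V p"
    and minimal: "\<forall>q. sublinear V q \<and> (\<forall>y\<in>carrier V. q y \<le> p y) \<longrightarrow> (\<forall>y\<in>carrier V. q y = p y)"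
  shows "\<And>y z. y \<in> carrier V \<Longrightarrow> z \<in> carrier V \<Longrightarrow> p (y \<oplus> z) = p y + p z"
    "\<And>t y. y \<in> carrier V \<Longrightarrow> p (of_real t \<odot> y) = t * p y"
    "\<And>y. y \<in> carrier V \<Longrightarrow> p (\<ominus> y) = - p y"
proof -
  show odd: "p (\<ominus> z) = - p z" if z: "z \<in> carrier V" for z
  proof -
    have "\<forall>y\<in>carrier V. lowered p z y = p y"
      using minimal sublinear_lowered[OF p z] lowered_le_self[OF p z] by blast
    then have "p (\<ominus> z) \<le> - p z"
      using lowered_uminus[OF p z] z by simp
    then show ?thesis
      using sublinear_uminus_ge[OF p z] by simp
  qed
  show "p (y \<oplus> z) = p y + p z" if y: "y \<in> carrier V" and z: "z \<in> carrier V" for y z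
  proof (rule antisym)
    show "p (y \<oplus> z) \<le> p y + p z" by (rule sublinear_add[OF p y z])
    have "(y \<oplus> z) \<oplus> \<ominus> z = y"
      using y z by (simp add: mod.M.a_assoc mod.M.r_neg)
    then show "p y + p z \<le> p (y \<oplus> z)"
      using sublinear_add[OF p, of "y \<oplus> z" "\<ominus> z"] y z odd[OF z] by simp
  qed
  show "p (of_real t \<odot> y) = t * p y" if y: "y \<in> carrier V" for t y
  proof -
    consider "t > 0" | "t = 0" | "t < 0" by linarith
    then show ?thesis
    proof cases
      case 3
      have "of_real t \<odot> y = \<ominus> (of_real (- t) \<odot> y)"
        using y by (simp add: a_inv_eq_smult smult_smult)
      then show ?thesis
        using odd[of "of_real (- t) \<odot> y"] sublinear_scale[OF p y, of "- t"] 3 y by simp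
    qed (use y sublinear_scale[OF p y] sublinear_zero[OF p] in auto)
  qed
qed

text \<open>
  Zorn's lemma applies to the sublinear functionals below \<open>q\<close>: the pointwise infimum of a chain is
  finite since \<open>- q (- y)\<close> is a lower bound at \<open>y\<close>. Taking the functionals extensional
  makes the pointwise order antisymmetric.
\<close>

lemma minimal_sublinear_exists:
  assumes q: "sublinear V q"
  obtains p where "sublinear V p" "\<And>y. y \<in> carrier V \<Longrightarrow> p y \<le> q y"
    "\<forall>r. sublinear V r \<and> (\<forall>y\<in>carrier V. r y \<le> p y) \<longrightarrow> (\<forall>y\<in>carrier V. r y = p y)"
proof -
  define A where "A = {p \<in> extensional (carrier V). sublinear V p \<and> (\<forall>y\<in>carrier V. p y \<le> q y)}"
  define below where "below = (\<lambda>p r :: 'v \<Rightarrow> real. \<forall>y\<in>carrier V. r y \<le> p y)"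
  have restr: "restrict r (carrier V) \<in> A" if "sublinear V r" "\<And>y. y \<in> carrier V \<Longrightarrow> r y \<le> q y" for r
    using that by (auto simp: A_def sublinear_def)
  have "\<exists>m\<in>A. \<forall>a\<in>A. below m a \<longrightarrow> a = m"
  proof (rule predicate_Zorn)
    show "partial_order_on A (relation_of below A)"
    proof (rule partial_order_on_relation_ofI)
      show "\<And>a. a \<in> A \<Longrightarrow> below a a" by (auto simp: below_def)
      show "\<And>a b c. \<lbrakk>a \<in> A; b \<in> A; c \<in> A\<rbrakk> \<Longrightarrow> below a b \<Longrightarrow> below b c \<Longrightarrow> below a c"
        by (force simp: below_def)
      show "a = b" if "a \<in> A" "b \<in> A" "below a b" "below b a" for a b
        using that by (intro extensionalityI[of a "carrier V" b]) (auto simp: A_def below_def intro: antisym)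
    qed
    fix C assume C: "C \<in> Chains (relation_of below A)"
    then have CA: "a \<in> A" if "a \<in> C" for a
      using that by (auto simp: Chains_def relation_of_def)
    have chain: "below a b \<or> below b a" if "a \<in> C" "b \<in> C" for a b
      using C that by (auto simp: Chains_def relation_of_def)
    show "\<exists>u\<in>A. \<forall>a\<in>C. below a u"
    proof (cases "C = {}")
      case True
      then show ?thesis using restr[OF q] by auto
    next
      case False
      then obtain a0 where a0: "a0 \<in> C" by auto
      have bdd: "bdd_below ((\<lambda>a. a y) ` C)" if y: "y \<in> carrier V" for y
      proof (rule bdd_belowI2)
        fix a assume "a \<in> C"
        then have "sublinear V a" "a (\<ominus> y) \<le> q (\<ominus> y)"
          using CA y by (auto simp: A_def)
        then show "- q (\<ominus> y) \<le> a y"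
          using sublinear_uminus_ge[of a y] y by linarith
      qed
      define u where "u = (\<lambda>y. INF a\<in>C. a y)"
      have u_le: "u y \<le> a y" if "a \<in> C" "y \<in> carrier V" for a y
        unfolding u_def using that by (intro cINF_lower bdd)
      have u_ge: "c \<le> u y" if "\<And>a. a \<in> C \<Longrightarrow> c \<le> a y" for c y
        unfolding u_def using False that by (intro cINF_greatest)
      have "sublinear V u"
        unfolding sublinear_def
      proof (intro conjI ballI allI impI)
        fix y z assume y: "y \<in> carrier V" and z: "z \<in> carrier V"
        have key: "u (y \<oplus> z) \<le> a y + b z" if ab: "a \<in> C" "b \<in> C" for a b
        proof -
          \<comment> \<open>the smaller one of \<open>a\<close> and \<open>b\<close> serves for both\<close>
          obtain c where c: "c \<in> C" "c y \<le> a y" "c z \<le> b z"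
            using chain[OF ab] ab y z by (auto simp: below_def)
          then have "c (y \<oplus> z) \<le> c y + c z"
            using CA y z by (intro sublinear_add) (auto simp: A_def)
          then show ?thesis
            using u_le[OF c(1), of "y \<oplus> z"] c y z by simp
        qed
        have "u (y \<oplus> z) - b z \<le> u y" if "b \<in> C" for b
          using key[OF _ that] by (intro u_ge) (simp add: algebra_simps)
        then have "u (y \<oplus> z) - u y \<le> u z"
          by (intro u_ge) (simp add: algebra_simps)
        then show "u (y \<oplus> z) \<le> u y + u z" by simp
      next
        fix t :: real and y assume t: "t > 0" and y: "y \<in> carrier V"
        have "u (of_real t \<odot> y) / t \<le> u y"
        proof (rule u_ge)
          fix a assume a: "a \<in> C"
          then have "a (of_real t \<odot> y) \<le> t * a y"
            using CA[OF a] t y by (auto simp: A_def sublinear_def)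
          then show "u (of_real t \<odot> y) / t \<le> a y"
            using u_le[OF a, of "of_real t \<odot> y"] t y by (simp add: field_simps)
        qed
        then show "u (of_real t \<odot> y) \<le> t * u y" using t by (simp add: field_simps)
      qed
      moreover have "u y \<le> q y" if "y \<in> carrier V" for y
        using u_le[OF a0 that] CA[OF a0] that by (force simp: A_def)
      ultimately have "restrict u (carrier V) \<in> A"
        by (rule restr)
      then show ?thesis
        using u_le by (auto simp: below_def intro!: bexI[of _ "restrict u (carrier V)"])
    qed
  qed
  then obtain p where p: "p \<in> A" and min: "\<And>a. a \<in> A \<Longrightarrow> below p a \<Longrightarrow> a = p"
    by blast
  show ?thesis
  proof
    show "sublinear V p" "\<And>y. y \<in> carrier V \<Longrightarrow> p y \<le> q y"
      using p by (auto simp: A_def)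
    have "\<forall>y\<in>carrier V. r y = p y" if r: "sublinear V r" "\<forall>y\<in>carrier V. r y \<le> p y" for r
    proof -
      have "restrict r (carrier V) = p"
        using p r by (intro min restr) (auto simp: A_def below_def intro: order_trans)
      then show ?thesis by (metis restrict_apply')
    qed
    then show "\<forall>r. sublinear V r \<and> (\<forall>y\<in>carrier V. r y \<le> p y) \<longrightarrow> (\<forall>y\<in>carrier V. r y = p y)"
      by blast
  qed
qed

text \<open>
  The norm, lowered in the direction \<open>x\<close>, has the value \<open>- \<parallel>x\<parallel>\<close> at \<open>- x\<close>; a minimal sublinear
  functional below it is real linear and attains the norm at \<open>x\<close>.
\<close>

theorem real_Hahn_Banach:
  assumes x: "x \<in> carrier V"
  shows "\<exists>u. (\<forall>y\<in>carrier V. \<forall>z\<in>carrier V. u (y \<oplus> z) = u y + u z) \<and>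
    (\<forall>t. \<forall>y\<in>carrier V. u (of_real t \<odot> y) = t * u y) \<and>
    (\<forall>y\<in>carrier V. \<bar>u y\<bar> \<le> vnorm V y) \<and> u x = vnorm V x"
proof -
  obtain p where p: "sublinear V p"
    and p_le: "\<And>y. y \<in> carrier V \<Longrightarrow> p y \<le> lowered (vnorm V) x y"
    and min: "\<forall>r. sublinear V r \<and> (\<forall>y\<in>carrier V. r y \<le> p y) \<longrightarrow> (\<forall>y\<in>carrier V. r y = p y)"
    using minimal_sublinear_exists[OF sublinear_lowered[OF sublinear_norm x]] by blast
  note lin = minimal_sublinear[OF p min]
  have p_norm: "p y \<le> vnorm V y" if "y \<in> carrier V" for y
    using p_le[OF that] lowered_le_self[OF sublinear_norm x that] by simp
  show ?thesis
  proof (intro exI[of _ p] conjI ballI allI)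
    show "\<bar>p y\<bar> \<le> vnorm V y" if "y \<in> carrier V" for y
      using p_norm[OF that] p_norm[of "\<ominus> y"] that lin(3)[OF that] by (simp add: norm_uminus)
    have "p (\<ominus> x) \<le> - vnorm V x"
      using p_le[of "\<ominus> x"] lowered_uminus[OF sublinear_norm x] x by simp
    then show "p x = vnorm V x"
      using p_norm[OF x] lin(3)[OF x] by simp
  qed (use lin in auto)
qed

end

text \<open>
  The real and the complex case differ in how norming functionals arise from the real linear ones.
  The equivalences themselves rest on
  this property and on the compactness of bounded closed sets of scalars.
\<close>

definition has_norming_functionals :: "('k::real_normed_field, 'v) normed_module \<Rightarrow> bool" where
  "has_norming_functionals V \<longleftrightarrow>
     (\<forall>x\<in>carrier V. \<exists>f\<in>closed_unit_ball (dual_space V). vnorm V x \<le> norm (f x))"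

lemma norming_functionals_real:
  fixes V :: "(real, 'v) normed_module"
  assumes "nspace V"
  shows "has_norming_functionals V"
  unfolding has_norming_functionals_def
proof
  interpret nspace V by fact
  fix x assume x: "x \<in> carrier V"
  obtain u where u:
    "\<And>y z. y \<in> carrier V \<Longrightarrow> z \<in> carrier V \<Longrightarrow> u (y \<oplus>\<^bsub>V\<^esub> z) = u y + u z"
    "\<And>t y. y \<in> carrier V \<Longrightarrow> u (of_real t \<odot>\<^bsub>V\<^esub> y) = t * u y"
    "\<And>y. y \<in> carrier V \<Longrightarrow> \<bar>u y\<bar> \<le> vnorm V y"
    "u x = vnorm V x"
    using real_Hahn_Banach[OF x] by blast
  have "restrict u (carrier V) \<in> closed_unit_ball (dual_space V)"
    using u by (auto simp: dual_ball_iff linear_map_def)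
  then show "\<exists>f\<in>closed_unit_ball (dual_space V). vnorm V x \<le> norm (f x)"
    using x u(4) by (intro bexI[of _ "restrict u (carrier V)"]) auto
qed

lemma norming_functionals_complex:
  fixes V :: "(complex, 'v) normed_module"
  assumes "nspace V"
  shows "has_norming_functionals V"
  unfolding has_norming_functionals_def
proof
  interpret nspace V by fact
  fix x assume x: "x \<in> carrier V"
  obtain u where u:
    "\<And>y z. y \<in> carrier V \<Longrightarrow> z \<in> carrier V \<Longrightarrow> u (y \<oplus>\<^bsub>V\<^esub> z) = u y + u z"
    "\<And>t y. y \<in> carrier V \<Longrightarrow> u (of_real t \<odot>\<^bsub>V\<^esub> y) = t * u y"
    "\<And>y. y \<in> carrier V \<Longrightarrow> \<bar>u y\<bar> \<le> vnorm V y"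
    "u x = vnorm V x"
    using real_Hahn_Banach[OF x] by blast
  \<comment> \<open>the complex linear functional with real part \<open>u\<close>\<close>
  define f where "f = (\<lambda>y\<in>carrier V. Complex (u y) (- u (\<i> \<odot>\<^bsub>V\<^esub> y)))"
  have u_smult: "u (c \<odot>\<^bsub>V\<^esub> y) = Re c * u y + Im c * u (\<i> \<odot>\<^bsub>V\<^esub> y)" if y: "y \<in> carrier V" for c y
  proof -
    have "c \<odot>\<^bsub>V\<^esub> y = of_real (Re c) \<odot>\<^bsub>V\<^esub> y \<oplus>\<^bsub>V\<^esub> of_real (Im c) \<odot>\<^bsub>V\<^esub> (\<i> \<odot>\<^bsub>V\<^esub> y)"
      using y by (simp add: smult_smult mult.commute complex_eq[symmetric] flip: smult_add_left)
    then show ?thesis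
      using y by (simp add: u)
  qed
  have add: "f (y \<oplus>\<^bsub>V\<^esub> z) = f y + f z" if "y \<in> carrier V" "z \<in> carrier V" for y z
    using that by (simp add: f_def u smult_add_right complex_eq_iff)
  have smult: "f (c \<odot>\<^bsub>V\<^esub> y) = c * f y" if "y \<in> carrier V" for c y
    using that u_smult[of y c] u_smult[of y "\<i> * c"]
    by (simp add: f_def complex_eq_iff smult_smult algebra_simps)
  have "norm (f y) \<le> vnorm V y" if y: "y \<in> carrier V" for y
  proof (cases "f y = 0")
    case False
    \<comment> \<open>rotate the value at \<open>y\<close> onto the positive axis, where it equals that of \<open>u\<close>\<close>
    define c where "c = cnj (f y) / of_real (norm (f y))"
    have c: "norm c = 1"
      using False by (simp add: c_def norm_divide)
    have "c * f y = of_real (norm (f y))"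
      using False by (simp add: c_def complex_norm_square[symmetric] power2_eq_square mult.commute)
    then have "norm (f y) = Re (f (c \<odot>\<^bsub>V\<^esub> y))"
      using y by (simp add: smult)
    also have "\<dots> \<le> vnorm V (c \<odot>\<^bsub>V\<^esub> y)"
      using y u(3)[of "c \<odot>\<^bsub>V\<^esub> y"] by (simp add: f_def)
    also have "\<dots> = vnorm V y"
      using y c by (simp add: norm_smult)
    finally show ?thesis .
  qed (use y in simp)
  then have "f \<in> closed_unit_ball (dual_space V)"
    using add smult by (auto simp: dual_ball_iff linear_map_def f_def)
  moreover have "vnorm V x \<le> norm (f x)"
    using abs_Re_le_cmod[of "f x"] x u(4) by (simp add: f_def)
  ultimately show "\<exists>f\<in>closed_unit_ball (dual_space V). vnorm V x \<le> norm (f x)" by blast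
qed

section \<open>The sequence spaces\<close>

lemma powr_convex_combination:
  fixes s t :: real
  assumes r: "1 \<le> r" and st: "0 \<le> s" "0 \<le> t" and lm: "0 < l" "0 < m" "l + m = 1"
  shows "(l * s + m * t) powr r \<le> l * s powr r + m * t powr r"
proof -
  have scale: "(c * x) powr r \<le> c * x powr r" if "0 < c" "c \<le> 1" "0 \<le> x" for c x :: real
  proof -
    have "c powr r \<le> c powr 1"
      using r that by (intro powr_mono') auto
    then show ?thesis
      using that by (simp add: powr_mult mult_right_mono)
  qed
  consider "s = 0" | "t = 0" | "s > 0" "t > 0" using st by linarith
  then show ?thesis
  proof cases
    case 3
    have l: "l = 1 - m" using lm by simp
    show ?thesis
      using convex_onD[OF powr_convex[OF r], of m s t] 3 lm unfolding l by simp
  qed (use scale lm st r in auto)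
qed

lemma sum_powr_le_0:
  fixes u :: "'a \<Rightarrow> real"
  assumes "finite I" "(\<Sum>i\<in>I. u i powr r) \<le> 0 powr r" "i \<in> I"
  shows "u i = 0"
proof -
  have "(\<Sum>i\<in>I. u i powr r) = 0"
    using assms(2) by (intro antisym sum_nonneg) auto
  then show ?thesis
    using assms by (subst (asm) sum_nonneg_eq_0_iff) auto
qed

text \<open>
  Minkowski's inequality by convexity: the sum is \<open>\<alpha> + \<beta>\<close> times a convex combination, with weights
  proportional to \<open>\<alpha>\<close> and \<open>\<beta>\<close>, of the normalized terms. Bounding sums of powers by powers, instead
  of taking roots, lets partial sums be compared with norms of infinite sequences.
\<close>

lemma Minkowski_sum:
  fixes u v :: "'a \<Rightarrow> real"
  assumes r: "1 \<le> r" and fin: "finite I"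
    and nonneg: "\<And>i. i \<in> I \<Longrightarrow> 0 \<le> u i" "\<And>i. i \<in> I \<Longrightarrow> 0 \<le> v i" "0 \<le> \<alpha>" "0 \<le> \<beta>"
    and u: "(\<Sum>i\<in>I. u i powr r) \<le> \<alpha> powr r" and v: "(\<Sum>i\<in>I. v i powr r) \<le> \<beta> powr r"
  shows "(\<Sum>i\<in>I. (u i + v i) powr r) \<le> (\<alpha> + \<beta>) powr r"
proof -
  consider "\<alpha> = 0" | "\<beta> = 0" | "\<alpha> > 0" "\<beta> > 0" using nonneg by linarith
  then show ?thesis
  proof cases
    case 1
    then have "u i = 0" if "i \<in> I" for i using sum_powr_le_0[OF fin _ that] u by blast
    then show ?thesis using v 1 by simp
  next
    case 2
    then have "v i = 0" if "i \<in> I" for i using sum_powr_le_0[OF fin _ that] v by blast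
    then show ?thesis using u 2 by simp
  next
    case 3
    let ?s = "\<alpha> + \<beta>"
    have s: "?s > 0" using 3 by simp
    have "(u i + v i) powr r \<le> ?s powr r * (\<alpha> / ?s * (u i powr r / \<alpha> powr r) + \<beta> / ?s * (v i powr r / \<beta> powr r))"
      if i: "i \<in> I" for i
    proof -
      have "u i + v i = ?s * (\<alpha> / ?s * (u i / \<alpha>) + \<beta> / ?s * (v i / \<beta>))"
        using 3 s by (simp add: add_divide_distrib[symmetric])
      also have "\<dots> powr r = ?s powr r * (\<alpha> / ?s * (u i / \<alpha>) + \<beta> / ?s * (v i / \<beta>)) powr r"
        by (rule powr_mult)
      also have "\<dots> \<le> ?s powr r * (\<alpha> / ?s * (u i / \<alpha>) powr r + \<beta> / ?s * (v i / \<beta>) powr r)"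
        using 3 nonneg i r
        by (intro mult_left_mono powr_convex_combination) (auto simp: add_divide_distrib[symmetric])
      finally show ?thesis
        using 3 nonneg i by (simp add: powr_divide)
    qed
    then have "(\<Sum>i\<in>I. (u i + v i) powr r) \<le>
        (\<Sum>i\<in>I. ?s powr r * (\<alpha> / ?s * (u i powr r / \<alpha> powr r) + \<beta> / ?s * (v i powr r / \<beta> powr r)))"
      by (rule sum_mono)
    also have "\<dots> = ?s powr r * (\<alpha> / ?s * ((\<Sum>i\<in>I. u i powr r) / \<alpha> powr r) + \<beta> / ?s * ((\<Sum>i\<in>I. v i powr r) / \<beta> powr r))"
      by (simp add: sum.distrib flip: sum_distrib_left sum_divide_distrib)
    also have "\<dots> \<le> ?s powr r * (\<alpha> / ?s * 1 + \<beta> / ?s * 1)"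
      using u v 3 by (intro mult_left_mono add_mono) auto
    also have "\<dots> = ?s powr r"
      using s by (simp add: add_divide_distrib[symmetric])
    finally show ?thesis .
  qed
qed

text \<open>
  Young's inequality for the normalized terms, summed.
\<close>

lemma Hoelder_sum:
  fixes u v :: "'a \<Rightarrow> real"
  assumes p: "1 < p" and pq: "1 / p + 1 / q = 1" and fin: "finite I"
    and nonneg: "\<And>i. i \<in> I \<Longrightarrow> 0 \<le> u i" "\<And>i. i \<in> I \<Longrightarrow> 0 \<le> v i" "0 \<le> \<alpha>" "0 \<le> \<beta>"
    and u: "(\<Sum>i\<in>I. u i powr p) \<le> \<alpha> powr p" and v: "(\<Sum>i\<in>I. v i powr q) \<le> \<beta> powr q"
  shows "(\<Sum>i\<in>I. u i * v i) \<le> \<alpha> * \<beta>"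
proof -
  have "0 < 1 / p" "1 / p < 1" using p by auto
  then have "1 / q > 0" "1 / q < 1" using pq by linarith+
  then have q: "q > 1" by (auto simp: field_simps zero_less_divide_iff split: if_splits)
  consider "\<alpha> = 0" | "\<beta> = 0" | "\<alpha> > 0" "\<beta> > 0" using nonneg by linarith
  then show ?thesis
  proof cases
    case 1
    then have "u i = 0" if "i \<in> I" for i using sum_powr_le_0[OF fin _ that] u by blast
    then show ?thesis using 1 by simp
  next
    case 2
    then have "v i = 0" if "i \<in> I" for i using sum_powr_le_0[OF fin _ that] v by blast
    then show ?thesis using 2 by simp
  next
    case 3
    have "u i * v i \<le> \<alpha> * \<beta> * (u i powr p / \<alpha> powr p / p + v i powr q / \<beta> powr q / q)" if i: "i \<in> I" for i
    proof -
      have "u i * v i = \<alpha> * \<beta> * (u i / \<alpha> * (v i / \<beta>))" using 3 by simp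
      also have "\<dots> \<le> \<alpha> * \<beta> * ((u i / \<alpha>) powr p / p + (v i / \<beta>) powr q / q)"
        using 3 nonneg i p q pq by (intro mult_left_mono Youngs_inequality) auto
      finally show ?thesis using 3 nonneg i by (simp add: powr_divide)
    qed
    then have "(\<Sum>i\<in>I. u i * v i) \<le> (\<Sum>i\<in>I. \<alpha> * \<beta> * (u i powr p / \<alpha> powr p / p + v i powr q / \<beta> powr q / q))"
      by (rule sum_mono)
    also have "\<dots> = \<alpha> * \<beta> * ((\<Sum>i\<in>I. u i powr p) / \<alpha> powr p / p + (\<Sum>i\<in>I. v i powr q) / \<beta> powr q / q)"
      by (simp add: sum.distrib sum_distrib_left[symmetric] sum_divide_distrib)
    also have "\<dots> \<le> \<alpha> * \<beta> * (1 / p + 1 / q)"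
      using u v 3 p q by (intro mult_left_mono add_mono divide_right_mono) auto
    finally show ?thesis using pq by simp
  qed
qed

lemma powr_le_powrD: "x powr r \<le> y powr r \<Longrightarrow> 0 < r \<Longrightarrow> 0 \<le> x \<Longrightarrow> 0 \<le> y \<Longrightarrow> x \<le> (y::real)"
  using powr_less_mono2[of r y x] by linarith

lemma lp_simps [simp]:
  "ring.zero (lp_space r) = (\<lambda>n. 0)" "ring.add (lp_space r) = (\<lambda>a b n. a n + b n)"
  "smult (lp_space r) = (\<lambda>c a n. c * a n)"
  by (simp_all add: lp_space_def)

lemma lp_carrier: "a \<in> carrier (lp_space r) \<longleftrightarrow> summable (\<lambda>n. norm (a n) powr r)"
  and lp_norm: "vnorm (lp_space r) a = (\<Sum>n. norm (a n) powr r) powr (1 / r)"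
  by (simp_all add: lp_space_def)

lemma lp_norm_nonneg: "0 \<le> vnorm (lp_space r) a"
  by (simp add: lp_norm)

text \<open>
  The norm and the carrier are determined by the finite partial sums alone, so that inequalities
  between norms reduce to inequalities for finite sums.
\<close>

lemma lpI:
  assumes "0 < r" "0 \<le> C" "\<And>N. (\<Sum>i<N. norm (a i) powr r) \<le> C powr r"
  shows "a \<in> carrier (lp_space r)" "vnorm (lp_space r) a \<le> C"
proof -
  have s: "summable (\<lambda>i. norm (a i) powr r)"
    using assms(3) by (intro summableI_nonneg_bounded) auto
  then show "a \<in> carrier (lp_space r)" by (simp add: lp_carrier)
  have "(\<Sum>i. norm (a i) powr r) powr (1 / r) \<le> (C powr r) powr (1 / r)"
    using assms by (intro powr_mono2 suminf_le_const[OF s] suminf_nonneg[OF s]) auto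
  then show "vnorm (lp_space r) a \<le> C"
    using assms by (simp add: lp_norm powr_powr)
qed

lemma lp_partial_sum:
  assumes "0 < r" "a \<in> carrier (lp_space r)" "finite I"
  shows "(\<Sum>i\<in>I. norm (a i) powr r) \<le> vnorm (lp_space r) a powr r"
proof -
  have s: "summable (\<lambda>i. norm (a i) powr r)" using assms by (simp add: lp_carrier)
  have "vnorm (lp_space r) a powr r = (\<Sum>i. norm (a i) powr r)"
    using assms suminf_nonneg[OF s] by (simp add: lp_norm powr_powr)
  then show ?thesis
    using assms by (simp add: sum_le_suminf[OF s])
qed

lemma lp_coordinate:
  assumes "0 < r" "a \<in> carrier (lp_space r)"
  shows "norm (a i) \<le> vnorm (lp_space r) a"
  using lp_partial_sum[OF assms, of "{i}"] assms
  by - (rule powr_le_powrD[of _ r], auto simp: lp_norm_nonneg)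

lemma lp_add:
  fixes a b :: "nat \<Rightarrow> 'k::real_normed_field"
  assumes r: "1 \<le> r" and a: "a \<in> carrier (lp_space r)" and b: "b \<in> carrier (lp_space r)"
  shows "(\<lambda>n. a n + b n) \<in> carrier (lp_space r)"
    "vnorm (lp_space r) (\<lambda>n. a n + b n) \<le> vnorm (lp_space r) a + vnorm (lp_space r) b"
proof -
  have r0: "0 < r" using r by simp
  have "(\<Sum>i<N. norm (a i + b i) powr r) \<le> (vnorm (lp_space r) a + vnorm (lp_space r) b) powr r" for N
  proof -
    have "(\<Sum>i<N. norm (a i + b i) powr r) \<le> (\<Sum>i<N. (norm (a i) + norm (b i)) powr r)"
      using r by (intro sum_mono powr_mono2 norm_triangle_ineq) auto
    also have "\<dots> \<le> (vnorm (lp_space r) a + vnorm (lp_space r) b) powr r"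
      by (intro Minkowski_sum r lp_partial_sum r0 a b) (auto simp: lp_norm_nonneg)
    finally show ?thesis .
  qed
  note bound = this
  show "(\<lambda>n. a n + b n) \<in> carrier (lp_space r)"
    "vnorm (lp_space r) (\<lambda>n. a n + b n) \<le> vnorm (lp_space r) a + vnorm (lp_space r) b"
    by (rule lpI[OF r0 add_nonneg_nonneg[OF lp_norm_nonneg lp_norm_nonneg] bound])+
qed

lemma lp_smult:
  fixes a :: "nat \<Rightarrow> 'k::real_normed_field"
  assumes r: "0 < r" and a: "a \<in> carrier (lp_space r)"
  shows "(\<lambda>n. c * a n) \<in> carrier (lp_space r)"
    "vnorm (lp_space r) (\<lambda>n. c * a n) = norm c * vnorm (lp_space r) a"
proof -
  have s: "summable (\<lambda>n. norm (a n) powr r)" using a by (simp add: lp_carrier)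
  have *: "norm (c * a n) powr r = norm c powr r * norm (a n) powr r" for n
    by (simp add: norm_mult powr_mult)
  show "(\<lambda>n. c * a n) \<in> carrier (lp_space r)"
    unfolding lp_carrier * by (rule summable_mult[OF s])
  show "vnorm (lp_space r) (\<lambda>n. c * a n) = norm c * vnorm (lp_space r) a"
    unfolding lp_norm * suminf_mult[OF s]
    using r suminf_nonneg[OF s] by (simp add: powr_mult powr_powr)
qed

lemma nspace_lp:
  assumes r: "1 \<le> r"
  shows "nspace (lp_space r :: ('k::real_normed_field, _) normed_module)"
proof
  let ?L = "lp_space r :: ('k, _) normed_module"
  have r0: "0 < r" using r by simp
  have zero: "(\<lambda>n. 0) \<in> carrier ?L" by (simp add: lp_carrier)
  have "abelian_group ?L"
  proof (rule abelian_groupI)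
    fix a assume a: "a \<in> carrier ?L"
    show "\<exists>b\<in>carrier ?L. b \<oplus>\<^bsub>?L\<^esub> a = \<zero>\<^bsub>?L\<^esub>"
      by (rule bexI[OF _ lp_smult(1)[OF r0 a, of "-1"]]) auto
  qed (auto simp: zero lp_add r algebra_simps)
  then have "Module.module scalars ?L"
    by (intro moduleI cring_scalars) (auto simp: lp_smult r0 algebra_simps)
  moreover have "vnorm ?L a = 0 \<longleftrightarrow> a = (\<lambda>n. 0)" if "a \<in> carrier ?L" for a
  proof
    assume "vnorm ?L a = 0"
    then show "a = (\<lambda>n. 0)"
      using lp_coordinate[OF r0 that] by (auto simp: fun_eq_iff)
  qed (simp add: lp_norm)
  ultimately show "normed_space ?L"
    by (auto simp: normed_space_def lp_norm_nonneg lp_add r lp_smult r0)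
qed

lemma lp_minus:
  fixes a b :: "nat \<Rightarrow> 'k::real_normed_field"
  assumes "1 \<le> r" "a \<in> carrier (lp_space r)" "b \<in> carrier (lp_space r)"
  shows "a \<ominus>\<^bsub>lp_space r\<^esub> b = (\<lambda>n. a n - b n)"
proof -
  interpret nspace "lp_space r :: ('k, _) normed_module" by (rule nspace_lp) fact
  show ?thesis
    using assms by (simp add: minus_eq_smult)
qed

text \<open>
  A partial sum involves finitely many coordinates only, so the bounds on the partial sums survive
  coordinatewise limits.
\<close>

lemma lp_coordinatewise_limit:
  fixes l :: "nat \<Rightarrow> 'k::real_normed_field"
  assumes r: "0 < r" and C: "0 \<le> C"
    and u: "\<forall>\<^sub>F n in sequentially. u n \<in> carrier (lp_space r) \<and> vnorm (lp_space r) (u n) \<le> C"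
    and lim: "\<And>i. (\<lambda>n. u n i) \<longlonglongrightarrow> l i"
  shows "l \<in> carrier (lp_space r)" "vnorm (lp_space r) l \<le> C"
proof -
  have "(\<Sum>i<N. norm (l i) powr r) \<le> C powr r" for N
  proof (rule tendsto_upperbound)
    show "(\<lambda>n. \<Sum>i<N. norm (u n i) powr r) \<longlonglongrightarrow> (\<Sum>i<N. norm (l i) powr r)"
      using r by (intro tendsto_sum tendsto_powr' tendsto_norm lim tendsto_const) auto
    show "\<forall>\<^sub>F n in sequentially. (\<Sum>i<N. norm (u n i) powr r) \<le> C powr r"
      using u
    proof eventually_elim
      case (elim n)
      then have "(\<Sum>i<N. norm (u n i) powr r) \<le> vnorm (lp_space r) (u n) powr r"
        by (intro lp_partial_sum r) auto
      also have "\<dots> \<le> C powr r"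
        using elim r by (intro powr_mono2) (auto simp: lp_norm_nonneg)
      finally show ?case .
    qed
  qed auto
  then show "l \<in> carrier (lp_space r)" "vnorm (lp_space r) l \<le> C"
    using lpI[OF r C] by auto
qed

lemma banach_lp:
  assumes r: "1 \<le> r"
  shows "banach_space (lp_space r :: ('k::{real_normed_field,complete_space}, _) normed_module)"
proof -
  let ?L = "lp_space r :: ('k, _) normed_module"
  interpret nspace ?L by (rule nspace_lp) fact
  have r0: "0 < r" using r by simp
  have "met.mcomplete"
    unfolding met.mcomplete_def
  proof (intro allI impI)
    fix \<sigma> assume MC: "met.MCauchy \<sigma>"
    then have \<sigma>: "\<sigma> n \<in> carrier ?L" for n
      by (auto simp: met.MCauchy_def)
    have diff: "\<sigma> n \<ominus>\<^bsub>?L\<^esub> \<sigma> m = (\<lambda>i. \<sigma> n i - \<sigma> m i)" for n m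
      by (rule lp_minus[OF r \<sigma> \<sigma>])
    have diff_in: "(\<lambda>i. \<sigma> n i - \<sigma> m i) \<in> carrier ?L" for n m
      using mod.M.minus_closed[OF \<sigma>[of n] \<sigma>[of m]] by (simp add: diff)
    have cauchy: "\<exists>N. \<forall>n\<ge>N. \<forall>m\<ge>N. vnorm ?L (\<lambda>i. \<sigma> n i - \<sigma> m i) < e" if e: "e > 0" for e
    proof -
      have "\<exists>N. \<forall>n\<ge>N. \<forall>m\<ge>N. vdist ?L (\<sigma> n) (\<sigma> m) < e"
        using MC e unfolding met.MCauchy_def by meson
      then show ?thesis
        using \<sigma> by (simp add: vdist_def diff)
    qed
    have "Cauchy (\<lambda>n. \<sigma> n i)" for i
    proof (rule metric_CauchyI)
      fix e :: real assume "e > 0"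
      then obtain N where "\<And>n m. n \<ge> N \<Longrightarrow> m \<ge> N \<Longrightarrow> vnorm ?L (\<lambda>i. \<sigma> n i - \<sigma> m i) < e"
        using cauchy by blast
      then show "\<exists>M. \<forall>m\<ge>M. \<forall>n\<ge>M. dist (\<sigma> m i) (\<sigma> n i) < e"
        unfolding dist_norm using lp_coordinate[OF r0 diff_in] by (meson le_less_trans)
    qed
    then have lim: "(\<lambda>n. \<sigma> n i) \<longlonglongrightarrow> lim (\<lambda>n. \<sigma> n i)" for i
      by (simp add: Cauchy_convergent_iff convergent_LIMSEQ_iff)
    define l where "l = (\<lambda>i. lim (\<lambda>n. \<sigma> n i))"
    have close: "\<exists>N. \<forall>n\<ge>N. (\<lambda>i. \<sigma> n i - l i) \<in> carrier ?L \<and> vnorm ?L (\<lambda>i. \<sigma> n i - l i) \<le> e"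
      if e: "e > 0" for e
    proof -
      obtain N where N: "\<And>n m. n \<ge> N \<Longrightarrow> m \<ge> N \<Longrightarrow> vnorm ?L (\<lambda>i. \<sigma> n i - \<sigma> m i) < e"
        using cauchy[OF e] by blast
      have "(\<lambda>i. \<sigma> n i - l i) \<in> carrier ?L \<and> vnorm ?L (\<lambda>i. \<sigma> n i - l i) \<le> e" if n: "n \<ge> N" for n
      proof -
        have ev: "\<forall>\<^sub>F m in sequentially. (\<lambda>i. \<sigma> n i - \<sigma> m i) \<in> carrier ?L \<and> vnorm ?L (\<lambda>i. \<sigma> n i - \<sigma> m i) \<le> e"
          using eventually_ge_at_top[of N]
          by eventually_elim (use N[OF n] diff_in in \<open>auto intro: less_imp_le\<close>)
        have "(\<lambda>m. \<sigma> n i - \<sigma> m i) \<longlonglongrightarrow> \<sigma> n i - l i" for i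
          unfolding l_def by (intro tendsto_diff tendsto_const lim)
        from lp_coordinatewise_limit[OF r0 less_imp_le[OF e] ev this] show ?thesis by blast
      qed
      then show ?thesis by blast
    qed
    have l: "l \<in> carrier ?L"
    proof -
      obtain n where n: "(\<lambda>i. \<sigma> n i - l i) \<in> carrier ?L"
        using close[of 1] by auto
      have "\<sigma> n \<ominus>\<^bsub>?L\<^esub> (\<lambda>i. \<sigma> n i - l i) = l"
        by (simp add: lp_minus[OF r \<sigma> n])
      then show ?thesis
        using mod.M.minus_closed[OF \<sigma> n] by metis
    qed
    have "\<exists>N. \<forall>n\<ge>N. \<sigma> n \<in> carrier ?L \<and> vdist ?L (\<sigma> n) l < e" if e: "e > 0" for e
    proof -
      have "e/2 > 0" using e by simp
      from close[OF this] obtain N where N: "\<And>n. n \<ge> N \<Longrightarrow> vnorm ?L (\<lambda>i. \<sigma> n i - l i) \<le> e/2"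
        by blast
      have "vdist ?L (\<sigma> n) l < e" if "n \<ge> N" for n
        using N[OF that] e \<sigma> l by (simp add: vdist_def lp_minus[OF r \<sigma> l])
      then show ?thesis using \<sigma> by blast
    qed
    then show "\<exists>l. limitin met.mtopology \<sigma> l sequentially"
      using l by (auto simp: met.limit_metric_sequentially)
  qed
  then show ?thesis
    using normed by (simp add: banach_space_def)
qed

section \<open>Weakly summable sequences\<close>

context nspace
begin

lemma weakly_p_summable_iff:
  assumes p: "0 < p"
  shows "weakly_p_summable p V x \<longleftrightarrow> range x \<subseteq> carrier V \<and>
    (\<exists>C\<ge>0. \<forall>f\<in>closed_unit_ball (dual_space V). \<forall>N. (\<Sum>n<N. norm (f (x n)) powr p) \<le> C powr p)"
proof (intro iffI conjI)
  assume L: "weakly_p_summable p V x"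
  then show "range x \<subseteq> carrier V" by (simp add: weakly_p_summable_def)
  let ?s = "\<lambda>f. \<Sum>n. norm (f (x n)) powr p"
  obtain B where B: "\<And>f. f \<in> closed_unit_ball (dual_space V) \<Longrightarrow> ?s f powr (1 / p) \<le> B"
    and s: "\<And>f. f \<in> closed_unit_ball (dual_space V) \<Longrightarrow> summable (\<lambda>n. norm (f (x n)) powr p)"
    using L by (auto simp: weakly_p_summable_def bdd_above_def)
  have "(\<Sum>n<N. norm (f (x n)) powr p) \<le> (max B 0) powr p" if f: "f \<in> closed_unit_ball (dual_space V)" for f N
  proof -
    have "(\<Sum>n<N. norm (f (x n)) powr p) \<le> ?s f"
      by (intro sum_le_suminf s f) auto
    also have "\<dots> = (?s f powr (1 / p)) powr p"
      using p suminf_nonneg[OF s[OF f]] by (simp add: powr_powr)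
    also have "\<dots> \<le> (max B 0) powr p"
      using p B[OF f] by (intro powr_mono2) auto
    finally show ?thesis .
  qed
  then show "\<exists>C\<ge>0. \<forall>f\<in>closed_unit_ball (dual_space V). \<forall>N. (\<Sum>n<N. norm (f (x n)) powr p) \<le> C powr p"
    by (intro exI[of _ "max B 0"]) auto
next
  assume R: "range x \<subseteq> carrier V \<and>
    (\<exists>C\<ge>0. \<forall>f\<in>closed_unit_ball (dual_space V). \<forall>N. (\<Sum>n<N. norm (f (x n)) powr p) \<le> C powr p)"
  then obtain C where C: "C \<ge> 0"
    "\<And>f N. f \<in> closed_unit_ball (dual_space V) \<Longrightarrow> (\<Sum>n<N. norm (f (x n)) powr p) \<le> C powr p"
    by blast
  have s: "summable (\<lambda>n. norm (f (x n)) powr p)" if "f \<in> closed_unit_ball (dual_space V)" for f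
    using C(2)[OF that] by (intro summableI_nonneg_bounded) auto
  have "(\<Sum>n. norm (f (x n)) powr p) powr (1 / p) \<le> C" if f: "f \<in> closed_unit_ball (dual_space V)" for f
  proof -
    have "(\<Sum>n. norm (f (x n)) powr p) powr (1 / p) \<le> (C powr p) powr (1 / p)"
      using p C(2)[OF f] suminf_nonneg[OF s[OF f]] by (intro powr_mono2 suminf_le_const s f) auto
    then show ?thesis using p C(1) by (simp add: powr_powr)
  qed
  then show "weakly_p_summable p V x"
    using R s by (auto simp: weakly_p_summable_def bdd_above_def)
qed

lemma weakly_p_summable_in: "weakly_p_summable p V x \<Longrightarrow> x n \<in> carrier V"
  by (auto simp: weakly_p_summable_def)

text \<open>
  Composites of functionals with operators are neither extensional nor in the unit ball; rescaling
  and restricting them makes the bound over the dual unit ball available.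
\<close>

lemma weakly_p_summable_bound:
  assumes p: "0 < p" and x: "weakly_p_summable p V x"
  obtains D where "0 \<le> D"
    "\<And>g C N. linear_map V scalar_space g \<Longrightarrow> 0 < C \<Longrightarrow> (\<And>y. y \<in> carrier V \<Longrightarrow> norm (g y) \<le> C * vnorm V y) \<Longrightarrow>
       (\<Sum>n<N. norm (g (x n)) powr p) \<le> (C * D) powr p"
proof -
  obtain D where D: "D \<ge> 0"
    "\<And>f N. f \<in> closed_unit_ball (dual_space V) \<Longrightarrow> (\<Sum>n<N. norm (f (x n)) powr p) \<le> D powr p"
    using x unfolding weakly_p_summable_iff[OF p] by blast
  have "(\<Sum>n<N. norm (g (x n)) powr p) \<le> (C * D) powr p"
    if g: "linear_map V scalar_space g" "0 < C" "\<And>y. y \<in> carrier V \<Longrightarrow> norm (g y) \<le> C * vnorm V y" for g C N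
  proof -
    define f where "f = (\<lambda>y\<in>carrier V. g y / of_real C)"
    have "f \<in> closed_unit_ball (dual_space V)"
      using g by (auto simp: dual_ball_iff f_def linear_map_def norm_divide field_simps)
    moreover have "norm (g (x n)) = C * norm (f (x n))" for n
      using weakly_p_summable_in[OF x] g(2) by (simp add: f_def norm_divide)
    then have "(\<Sum>n<N. norm (g (x n)) powr p) = C powr p * (\<Sum>n<N. norm (f (x n)) powr p)"
      using g(2) by (simp add: powr_mult sum_distrib_left)
    ultimately show ?thesis
      using D g(2) by (simp add: powr_mult mult_left_mono)
  qed
  then show thesis using D(1) that by blast
qed

lemma weakly_p_summable_tendsto_0:
  assumes p: "0 < p" and x: "weakly_p_summable p V x" and f: "f \<in> carrier (dual_space V)"
  shows "(\<lambda>n. f (x n)) \<longlonglongrightarrow> 0"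
proof -
  obtain D where D:
    "\<And>g C N. linear_map V scalar_space g \<Longrightarrow> 0 < C \<Longrightarrow> (\<And>y. y \<in> carrier V \<Longrightarrow> norm (g y) \<le> C * vnorm V y) \<Longrightarrow>
       (\<Sum>n<N. norm (g (x n)) powr p) \<le> (C * D) powr p"
    using weakly_p_summable_bound[OF p x] by metis
  have "norm (f y) \<le> (vnorm (dual_space V) f + 1) * vnorm V y" if "y \<in> carrier V" for y
    using dual_norm_bound[OF f that] norm_nonneg[OF that] by (simp add: algebra_simps)
  then have "(\<Sum>n<N. norm (f (x n)) powr p) \<le> ((vnorm (dual_space V) f + 1) * D) powr p" for N
    using dual_norm_nonneg[OF f] by (intro D dual_linear[OF f]) auto
  then have "summable (\<lambda>n. norm (f (x n)) powr p)"
    by (intro summableI_nonneg_bounded) auto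
  then have "(\<lambda>n. norm (f (x n)) powr p) \<longlonglongrightarrow> 0"
    by (rule summable_LIMSEQ_zero)
  then have "(\<lambda>n. (norm (f (x n)) powr p) powr (1 / p)) \<longlonglongrightarrow> 0 powr (1 / p)"
    using p by (intro tendsto_powr' tendsto_const) auto
  then show ?thesis
    using p by (simp add: powr_powr tendsto_norm_zero_iff)
qed

lemma weakly_p_summable_add:
  assumes p: "1 \<le> p" and x: "weakly_p_summable p V x" and y: "weakly_p_summable p V y"
  shows "weakly_p_summable p V (\<lambda>n. x n \<oplus> y n)"
proof -
  have p0: "0 < p" using p by simp
  obtain C where C: "C \<ge> 0"
    "\<And>f N. f \<in> closed_unit_ball (dual_space V) \<Longrightarrow> (\<Sum>n<N. norm (f (x n)) powr p) \<le> C powr p"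
    using x unfolding weakly_p_summable_iff[OF p0] by blast
  obtain D where D: "D \<ge> 0"
    "\<And>f N. f \<in> closed_unit_ball (dual_space V) \<Longrightarrow> (\<Sum>n<N. norm (f (y n)) powr p) \<le> D powr p"
    using y unfolding weakly_p_summable_iff[OF p0] by blast
  have "(\<Sum>n<N. norm (f (x n \<oplus> y n)) powr p) \<le> (C + D) powr p" if f: "f \<in> closed_unit_ball (dual_space V)" for f N
  proof -
    have "f (x n \<oplus> y n) = f (x n) + f (y n)" for n
      using f weakly_p_summable_in[OF x] weakly_p_summable_in[OF y]
      by (intro dual_add) (auto simp: closed_unit_ball_def)
    then have "(\<Sum>n<N. norm (f (x n \<oplus> y n)) powr p) \<le> (\<Sum>n<N. (norm (f (x n)) + norm (f (y n))) powr p)"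
      using p by (intro sum_mono powr_mono2) (auto simp: norm_triangle_ineq)
    also have "\<dots> \<le> (C + D) powr p"
      using C D f by (intro Minkowski_sum p) auto
    finally show ?thesis .
  qed
  then show ?thesis
    unfolding weakly_p_summable_iff[OF p0] using C(1) D(1) weakly_p_summable_in[OF x] weakly_p_summable_in[OF y]
    by (intro conjI exI[of _ "C + D"]) auto
qed

lemma weakly_p_summable_of_norms:
  assumes p: "0 < p" and x: "\<And>n. x n \<in> carrier V" and C: "0 \<le> C"
    and bound: "\<And>N. (\<Sum>n<N. vnorm V (x n) powr p) \<le> C powr p"
  shows "weakly_p_summable p V x"
proof -
  have "(\<Sum>n<N. norm (f (x n)) powr p) \<le> C powr p" if f: "f \<in> closed_unit_ball (dual_space V)" for f N
  proof -
    have "(\<Sum>n<N. norm (f (x n)) powr p) \<le> (\<Sum>n<N. vnorm V (x n) powr p)"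
      using p f x by (intro sum_mono powr_mono2) (auto simp: dual_ball_iff)
    then show ?thesis using bound[of N] by simp
  qed
  then show ?thesis
    unfolding weakly_p_summable_iff[OF p] using C x by auto
qed

end

lemma (in nspace_pair) weakly_p_summable_image:
  assumes p: "0 < p" and T: "operator V W T" and x: "weakly_p_summable p V x"
  shows "weakly_p_summable p W (\<lambda>n. T (x n))"
proof -
  have lin: "linear_map V W T" using T by (rule operator_linear)
  obtain C0 where C0: "\<And>y. y \<in> carrier V \<Longrightarrow> vnorm W (T y) \<le> C0 * vnorm V y"
    using T by (auto simp: operator_iff)
  define C where "C = \<bar>C0\<bar> + 1"
  have C: "C > 0" by (simp add: C_def)
  obtain D where D: "0 \<le> D"
    "\<And>g C N. linear_map V scalar_space g \<Longrightarrow> 0 < C \<Longrightarrow> (\<And>y. y \<in> carrier V \<Longrightarrow> norm (g y) \<le> C * vnorm V y) \<Longrightarrow>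
       (\<Sum>n<N. norm (g (x n)) powr p) \<le> (C * D) powr p"
    using V.weakly_p_summable_bound[OF p x] by metis
  have "(\<Sum>n<N. norm (f (T (x n))) powr p) \<le> (C * D) powr p" if f: "f \<in> closed_unit_ball (dual_space W)" for f N
  proof (rule D(2)[OF _ C])
    show "linear_map V scalar_space (\<lambda>y. f (T y))"
      using f lin by (auto simp: W.dual_ball_iff linear_map_def Pi_iff)
    fix y assume y: "y \<in> carrier V"
    have "norm (f (T y)) \<le> vnorm W (T y)"
      using f linear_map_in[OF lin y] by (auto simp: W.dual_ball_iff)
    also have "\<dots> \<le> C0 * vnorm V y" by (rule C0[OF y])
    also have "\<dots> \<le> C * vnorm V y"
      using y by (intro mult_right_mono) (auto simp: C_def)
    finally show "norm (f (T y)) \<le> C * vnorm V y" .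
  qed
  then show ?thesis
    unfolding W.weakly_p_summable_iff[OF p]
    using C D(1) linear_map_in[OF lin V.weakly_p_summable_in[OF x]]
    by (intro conjI exI[of _ "C * D"]) auto
qed

primrec lin_comb :: "('k, 'v) normed_module \<Rightarrow> (nat \<Rightarrow> 'k) \<Rightarrow> (nat \<Rightarrow> 'v) \<Rightarrow> nat \<Rightarrow> 'v" where
  "lin_comb V a x 0 = \<zero>\<^bsub>V\<^esub>"
| "lin_comb V a x (Suc n) = lin_comb V a x n \<oplus>\<^bsub>V\<^esub> a n \<odot>\<^bsub>V\<^esub> x n"

context nspace
begin

lemma lin_comb_in: "(\<And>n. x n \<in> carrier V) \<Longrightarrow> lin_comb V a x N \<in> carrier V"
  by (induction N) auto

lemma dual_lin_comb:
  "f \<in> carrier (dual_space V) \<Longrightarrow> (\<And>n. x n \<in> carrier V) \<Longrightarrow> f (lin_comb V a x N) = (\<Sum>n<N. a n * f (x n))"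
  by (induction N) (auto simp: dual_zero dual_add dual_smult lin_comb_in)

text \<open>
  An upper \<open>q\<close>-estimate for linear combinations is dual to weak \<open>p\<close>-summability: test it with the
  coefficients \<open>a\<^sub>n\<close> for which \<open>a\<^sub>n f(x\<^sub>n) = \<bar>f(x\<^sub>n)\<bar>\<^sup>p\<close>, the equality case of
  Hoelder's inequality.
\<close>

lemma weakly_p_summable_of_upper_estimate:
  assumes p: "1 < p" and pq: "1 / p + 1 / q = 1" and x: "\<And>n. x n \<in> carrier V" and C: "0 \<le> C"
    and est: "\<And>a N \<beta>. 0 \<le> \<beta> \<Longrightarrow> (\<Sum>n<N. norm (a n) powr q) \<le> \<beta> powr q \<Longrightarrow> vnorm V (lin_comb V a x N) \<le> C * \<beta>"
  shows "weakly_p_summable p V x"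
proof -
  have p0: "0 < p" using p by simp
  have "0 < 1 / p" "1 / p < 1" using p by auto
  then have "1 / q > 0" using pq by linarith
  then have q: "q > 0" by (auto simp: zero_less_divide_iff)
  have pq': "(p - 1) * q = p"
    using p q pq by (simp add: field_simps)
  have "(\<Sum>n<N. norm (f (x n)) powr p) \<le> C powr p" if f: "f \<in> closed_unit_ball (dual_space V)" for f N
  proof -
    have fd: "f \<in> carrier (dual_space V)" using f by (simp add: closed_unit_ball_def)
    define S where "S = (\<Sum>n<N. norm (f (x n)) powr p)"
    have S0: "0 \<le> S" by (auto simp: S_def intro: sum_nonneg)
    define a where "a = (\<lambda>n. of_real (norm (f (x n)) powr p) / f (x n))"
    have a: "a n * f (x n) = of_real (norm (f (x n)) powr p)" for n
      using p by (cases "f (x n) = 0") (auto simp: a_def)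
    have "norm (a n) powr q = norm (f (x n)) powr p" for n
    proof (cases "f (x n) = 0")
      case False
      then have "norm (a n) = norm (f (x n)) powr (p - 1)"
        by (simp add: a_def norm_divide powr_diff)
      then show ?thesis by (simp add: powr_powr pq')
    qed (use p in \<open>simp add: a_def\<close>)
    then have "(\<Sum>n<N. norm (a n) powr q) = S" by (simp add: S_def)
    also have "S = (S powr (1 / q)) powr q" using S0 q by (simp add: powr_powr)
    finally have "vnorm V (lin_comb V a x N) \<le> C * S powr (1 / q)"
      by (intro est) auto
    moreover have "f (lin_comb V a x N) = of_real S"
      using fd x by (simp add: dual_lin_comb a S_def)
    then have "S \<le> vnorm V (lin_comb V a x N)"
      using f lin_comb_in[of x a N, OF x] S0 by (force simp: dual_ball_iff)
    ultimately have le: "S \<le> C * S powr (1 / q)" by simp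
    have "S \<le> C powr p"
    proof (cases "S = 0")
      case False
      then have pos: "S > 0" using S0 by simp
      have "S = S powr (1 / p) * S powr (1 / q)"
        using pos pq by (simp add: powr_add[symmetric])
      then have "S powr (1 / p) \<le> C"
        using le pos by (metis mult_le_cancel_right_pos powr_gt_zero less_numeral_extra(3))
      then have "(S powr (1 / p)) powr p \<le> C powr p"
        using p by (intro powr_mono2) auto
      then show ?thesis using pos p by (simp add: powr_powr)
    qed simp
    then show ?thesis by (simp add: S_def)
  qed
  then show ?thesis
    unfolding weakly_p_summable_iff[OF p0] using C x by auto
qed

end

lemma norm_sum_powr_disjoint:
  fixes u :: "'a \<Rightarrow> 'b::real_normed_vector"
  assumes "finite K" "0 < q" "\<And>j k. j \<in> K \<Longrightarrow> k \<in> K \<Longrightarrow> j \<noteq> k \<Longrightarrow> u j = 0 \<or> u k = 0"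
  shows "norm (\<Sum>k\<in>K. u k) powr q = (\<Sum>k\<in>K. norm (u k) powr q)"
proof (cases "\<exists>k0\<in>K. u k0 \<noteq> 0")
  case True
  then obtain k0 where k0: "k0 \<in> K" "u k0 \<noteq> 0" by blast
  have "u k = 0" if "k \<in> K - {k0}" for k
    using assms(3)[of k k0] that k0 by auto
  then show ?thesis
    using assms(1,2) k0 by (simp add: sum.remove[of K k0])
qed (use assms in auto)

text \<open>
  For disjointly supported vectors the \<open>q\<close>-th powers of the norms add up, which gives the upper
  estimate with the constant \<open>B\<close>.
\<close>

lemma lp_weakly_p_summable_disjoint:
  fixes z :: "nat \<Rightarrow> nat \<Rightarrow> 'k::real_normed_field"
  assumes p: "1 < p" and pq: "1 / p + 1 / q = 1" and q: "1 < q"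
    and z: "\<And>n. z n \<in> carrier (lp_space q)" "\<And>n. vnorm (lp_space q) (z n) \<le> B"
    and disjoint: "\<And>i j k. j \<noteq> k \<Longrightarrow> z j i = 0 \<or> z k i = 0"
  shows "weakly_p_summable p (lp_space q) z"
proof -
  interpret nspace "lp_space q :: ('k, _) normed_module" using q by (intro nspace_lp) simp
  have B: "0 \<le> B" using lp_norm_nonneg z(2) order_trans by blast
  have comb: "lin_comb (lp_space q) a z N = (\<lambda>i. \<Sum>k<N. a k * z k i)" for a N
    by (induction N) auto
  show ?thesis
  proof (rule weakly_p_summable_of_upper_estimate[OF p pq z(1) B])
    fix a :: "nat \<Rightarrow> 'k" and N \<beta>
    assume \<beta>: "0 \<le> \<beta>" "(\<Sum>n<N. norm (a n) powr q) \<le> \<beta> powr q"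
    have "(\<Sum>i<J. norm (\<Sum>k<N. a k * z k i) powr q) \<le> (B * \<beta>) powr q" for J
    proof -
      have "(\<Sum>i<J. norm (\<Sum>k<N. a k * z k i) powr q) = (\<Sum>i<J. \<Sum>k<N. norm (a k * z k i) powr q)"
        using q disjoint by (intro sum.cong refl norm_sum_powr_disjoint) auto
      also have "\<dots> = (\<Sum>k<N. norm (a k) powr q * (\<Sum>i<J. norm (z k i) powr q))"
        by (subst sum.swap) (simp add: norm_mult powr_mult sum_distrib_left)
      also have "\<dots> \<le> (\<Sum>k<N. norm (a k) powr q * B powr q)"
      proof (intro sum_mono mult_left_mono)
        fix k
        have "(\<Sum>i<J. norm (z k i) powr q) \<le> vnorm (lp_space q) (z k) powr q"
          using q z(1) by (intro lp_partial_sum) auto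
        also have "\<dots> \<le> B powr q"
          using q z(2) by (intro powr_mono2) (auto simp: lp_norm_nonneg)
        finally show "(\<Sum>i<J. norm (z k i) powr q) \<le> B powr q" .
      qed auto
      also have "\<dots> = (\<Sum>k<N. norm (a k) powr q) * B powr q"
        by (simp add: sum_distrib_right)
      also have "\<dots> \<le> \<beta> powr q * B powr q"
        using \<beta>(2) by (intro mult_right_mono) auto
      finally show ?thesis by (simp add: powr_mult mult.commute)
    qed
    then show "vnorm (lp_space q) (lin_comb (lp_space q) a z N) \<le> B * \<beta>"
      unfolding comb using q B \<beta>(1) by (intro lpI) auto
  qed
qed

lemma lp_weakly_p_summable_unit_vectors:
  assumes p: "1 < p" and pq: "1 / p + 1 / q = 1" and q: "1 < q"
  defines "e \<equiv> \<lambda>n i. if i = n then 1 else 0 :: 'k::real_normed_field"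
  shows "weakly_p_summable p (lp_space q) e"
proof -
  have "(\<Sum>i<N. norm (e n i) powr q) \<le> 1 powr q" for n N
  proof -
    have "(\<Sum>i<N. norm (e n i) powr q) = (\<Sum>i<N. if i = n then 1 else 0)"
      using q by (intro sum.cong) (auto simp: e_def)
    then show ?thesis by simp
  qed
  then have "e n \<in> carrier (lp_space q)" "vnorm (lp_space q) (e n) \<le> 1" for n
    using lpI[of q 1 "e n"] q by auto
  then show ?thesis
    by (rule lp_weakly_p_summable_disjoint[OF p pq q]) (auto simp: e_def)
qed

text \<open>
  One step of the gliding hump: far enough out in a coordinatewise null sequence there is a member
  that almost lives on a finite interval of coordinates beyond a prescribed one.
\<close>

lemma gliding_hump_step:
  fixes w :: "nat \<Rightarrow> nat \<Rightarrow> 'k::real_normed_field"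
  assumes q: "1 < q" and w: "\<And>n. w n \<in> carrier (lp_space q)" and lim: "\<And>i. (\<lambda>n. w n i) \<longlonglongrightarrow> 0"
    and e: "e > 0"
  obtains s b where "s0 < s" "a \<le> b"
    "(\<lambda>i. if a \<le> i \<and> i < b then 0 else w s i) \<in> carrier (lp_space q)"
    "vnorm (lp_space q) (\<lambda>i. if a \<le> i \<and> i < b then 0 else w s i) \<le> e"
proof -
  let ?e = "e powr q / 2"
  have e': "?e > 0" using e by simp
  have "(\<lambda>n. \<Sum>i<a. norm (w n i) powr q) \<longlonglongrightarrow> (\<Sum>i<a. norm (0::'k) powr q)"
    using q by (intro tendsto_sum tendsto_powr' tendsto_norm lim tendsto_const) auto
  then have "\<forall>\<^sub>F n in sequentially. (\<Sum>i<a. norm (w n i) powr q) < ?e"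
    using e' q by (intro order_tendstoD(2)[where y = 0]) auto
  then have "\<forall>\<^sub>F n in sequentially. (\<Sum>i<a. norm (w n i) powr q) < ?e \<and> s0 < n"
    using eventually_gt_at_top[of s0] by eventually_elim auto
  then obtain s where s: "s0 < s" "(\<Sum>i<a. norm (w s i) powr q) < ?e"
    by (metis (no_types, lifting) eventually_sequentially order_refl)
  obtain b0 where b0: "\<And>m n. m \<ge> b0 \<Longrightarrow> norm (\<Sum>i\<in>{m..<n}. norm (w s i) powr q) < ?e"
    using w[of s] e' unfolding lp_carrier summable_Cauchy by meson
  define b where "b = max a b0"
  let ?r = "\<lambda>i. if a \<le> i \<and> i < b then 0 else w s i"
  have "(\<Sum>i<N. norm (?r i) powr q) \<le> e powr q" for N
  proof -
    have "(\<Sum>i<N. norm (?r i) powr q) = (\<Sum>i\<in>{..<N} - {a..<b}. norm (w s i) powr q)"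
      by (intro sum.mono_neutral_cong_right) auto
    also have "\<dots> \<le> (\<Sum>i\<in>{..<a} \<union> {b..<N}. norm (w s i) powr q)"
      by (intro sum_mono2) auto
    also have "\<dots> \<le> (\<Sum>i<a. norm (w s i) powr q) + (\<Sum>i\<in>{b..<N}. norm (w s i) powr q)"
      by (subst sum.union_disjoint) (auto simp: b_def)
    also have "\<dots> \<le> ?e + ?e"
      using s(2) b0[of b N] by (intro add_mono) (auto simp: b_def)
    finally show ?thesis by simp
  qed
  then have "?r \<in> carrier (lp_space q)" "vnorm (lp_space q) ?r \<le> e"
    using lpI[of q e ?r] q e by auto
  then show thesis
    using that[of s b] s(1) by (auto simp: b_def)
qed

text \<open>
  The chosen members are the sum of a disjointly supported bounded sequence and a sequence with
  geometrically decreasing norms, and both of these are weakly summable.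
\<close>

lemma gliding_hump:
  fixes w :: "nat \<Rightarrow> nat \<Rightarrow> 'k::real_normed_field"
  assumes p: "1 < p" and pq: "1 / p + 1 / q = 1" and q: "1 < q"
    and w: "\<And>n. w n \<in> carrier (lp_space q)" "\<And>n. vnorm (lp_space q) (w n) \<le> B"
    and lim: "\<And>i. (\<lambda>n. w n i) \<longlonglongrightarrow> 0"
  obtains s where "strict_mono (s :: nat \<Rightarrow> nat)" "weakly_p_summable p (lp_space q) (\<lambda>n. w (s n))"
proof -
  interpret nspace "lp_space q :: ('k, _) normed_module" using q by (intro nspace_lp) simp
  have B: "0 \<le> B" using lp_norm_nonneg w(2) order_trans by blast
  define rest where "rest = (\<lambda>(s, a, b) i. if a \<le> i \<and> i < b then 0 else w s i)"
  \<comment> \<open>a triple \<open>(s, a, b)\<close> selects the member \<open>w s\<close> and the interval \<open>[a, b)\<close> of its hump\<close>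
  define good where "good = (\<lambda>(k::nat) (t :: nat \<times> nat \<times> nat). fst (snd t) \<le> snd (snd t) \<and>
    rest t \<in> carrier (lp_space q) \<and> vnorm (lp_space q) (rest t) \<le> (1/2) ^ k)"
  have step: "\<exists>t. good k t \<and> s0 < fst t \<and> fst (snd t) = a" for k s0 a
  proof -
    have "(1/2 :: real) ^ k > 0" by simp
    from gliding_hump_step[OF q w(1) lim this, of s0 a] obtain s b where "s0 < s" "a \<le> b"
      "(\<lambda>i. if a \<le> i \<and> i < b then 0 else w s i) \<in> carrier (lp_space q)"
      "vnorm (lp_space q) (\<lambda>i. if a \<le> i \<and> i < b then 0 else w s i) \<le> (1/2) ^ k" by blast
    then show ?thesis
      by (intro exI[of _ "(s, a, b)"]) (auto simp: good_def rest_def)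
  qed
  have "\<exists>t. \<forall>k. good k (t k) \<and> (fst (t k) < fst (t (Suc k)) \<and> fst (snd (t (Suc k))) = snd (snd (t k)))"
    using step by (intro dependent_nat_choice) blast+
  then obtain t where good: "\<And>k. good k (t k)"
    and next_s: "\<And>k. fst (t k) < fst (t (Suc k))"
    and next_a: "\<And>k. fst (snd (t (Suc k))) = snd (snd (t k))" by blast
  define s where "s = (\<lambda>k. fst (t k))"
  define a where "a = (\<lambda>k. fst (snd (t k)))"
  have s: "strict_mono s"
    using next_s by (auto simp: s_def strict_mono_Suc_iff)
  have "mono a"
    using good next_a by (auto simp: mono_iff_le_Suc a_def good_def)
  define z where "z = (\<lambda>k i. if a k \<le> i \<and> i < a (Suc k) then w (s k) i else 0)"
  have split: "w (s k) = (\<lambda>i. z k i + rest (t k) i)" for k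
    by (auto simp: z_def rest_def s_def a_def next_a split: prod.splits)
  have "(\<Sum>i<N. norm (z k i) powr q) \<le> B powr q" for k N
  proof -
    have "(\<Sum>i<N. norm (z k i) powr q) \<le> (\<Sum>i<N. norm (w (s k) i) powr q)"
      using q by (intro sum_mono powr_mono2) (auto simp: z_def)
    also have "\<dots> \<le> vnorm (lp_space q) (w (s k)) powr q"
      using q w(1) by (intro lp_partial_sum) auto
    also have "\<dots> \<le> B powr q"
      using q w(2) by (intro powr_mono2) (auto simp: lp_norm_nonneg)
    finally show ?thesis .
  qed
  then have z: "z k \<in> carrier (lp_space q)" "vnorm (lp_space q) (z k) \<le> B" for k
    using lpI[of q B "z k"] q B by auto
  have "z j i = 0 \<or> z k i = 0" if "j < k" for i j k
    using monoD[OF \<open>mono a\<close>, of "Suc j" k] that by (auto simp: z_def)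
  then have "z j i = 0 \<or> z k i = 0" if "j \<noteq> k" for i j k
    using that by (metis linorder_neqE_nat)
  then have "weakly_p_summable p (lp_space q) z"
    using z by (intro lp_weakly_p_summable_disjoint[OF p pq q]) auto
  moreover have "weakly_p_summable p (lp_space q) (\<lambda>k. rest (t k))"
  proof (rule weakly_p_summable_of_norms)
    show "0 < p" using p by simp
    show "rest (t k) \<in> carrier (lp_space q)" for k using good[of k] by (simp add: good_def)
    show "(0::real) \<le> 2 powr (1 / p)" by simp
    fix N
    have "(\<Sum>k<N. vnorm (lp_space q) (rest (t k)) powr p) \<le> (\<Sum>k<N. (1/2) ^ k)"
    proof (rule sum_mono)
      fix k
      have "vnorm (lp_space q) (rest (t k)) powr p \<le> ((1/2) ^ k) powr p"
        using good[of k] p by (intro powr_mono2) (auto simp: good_def lp_norm_nonneg)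
      also have "\<dots> \<le> ((1/2) ^ k) powr 1"
        using p by (intro powr_mono') (auto simp: power_le_one)
      finally show "vnorm (lp_space q) (rest (t k)) powr p \<le> (1/2) ^ k" by simp
    qed
    also have "\<dots> \<le> (2 powr (1 / p)) powr p"
      using p by (simp add: powr_powr sum_gp_strict)
    finally show "(\<Sum>k<N. vnorm (lp_space q) (rest (t k)) powr p) \<le> (2 powr (1 / p)) powr p" .
  qed
  ultimately have "weakly_p_summable p (lp_space q) (\<lambda>k. z k \<oplus>\<^bsub>lp_space q\<^esub> rest (t k))"
    using p by (intro weakly_p_summable_add) auto
  then have "weakly_p_summable p (lp_space q) (\<lambda>k. w (s k))"
    by (simp add: split)
  with s show thesis by (rule that)
qed

text \<open>
  A bounded sequence has a coordinatewise convergent subsequence, whose limit is in the space since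
  balls are closed under such limits. The differences to the limit are bounded and coordinatewise
  null, so the gliding hump applies to them.
\<close>

theorem lp_in_W_class:
  assumes p: "1 < p" and pq: "1 / p + 1 / q = 1" and q: "1 < q"
  shows "(lp_space q :: ('k::{real_normed_field,heine_borel}, _) normed_module) \<in> W_class p"
proof -
  let ?L = "lp_space q :: ('k, _) normed_module"
  interpret nspace ?L using q by (intro nspace_lp) simp
  have q0: "0 < q" and q1: "1 \<le> q" using q by auto
  have "\<exists>r. strict_mono r \<and> weakly_p_convergent p ?L (y \<circ> r)"
    if bounded: "range y \<subseteq> carrier ?L \<and> norm_bounded ?L (range y)" for y :: "nat \<Rightarrow> nat \<Rightarrow> 'k"
  proof -
    have y: "y n \<in> carrier ?L" for n using bounded by auto
    obtain M where M: "\<And>n. vnorm ?L (y n) \<le> M"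
      using bounded by (auto simp: norm_bounded_iff)
    have M0: "0 \<le> M" using M[of 0] lp_norm_nonneg[of q "y 0"] by linarith
    have "norm (y n i) \<le> M" for n i
      using lp_coordinate[OF q0 y, of n i] M[of n] by simp
    then obtain k :: "nat \<Rightarrow> nat" where k: "strict_mono k"
      and conv: "\<And>i. i \<in> UNIV \<Longrightarrow> \<exists>l. (\<lambda>n. y (k n) i) \<longlonglongrightarrow> l"
      using function_convergent_subsequence[of UNIV y M] by (metis countableI_type)
    then obtain l where l: "\<And>i. (\<lambda>n. y (k n) i) \<longlonglongrightarrow> l i"
      by (metis UNIV_I)
    have lL: "l \<in> carrier ?L"
      using lp_coordinatewise_limit[OF q0 M0 _ l] y M by simp
    define w where "w = (\<lambda>n. y (k n) \<ominus>\<^bsub>?L\<^esub> l)"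
    have w_eq: "w n i = y (k n) i - l i" for n i
      by (simp add: w_def lp_minus[OF q1 y lL])
    have "w n \<in> carrier ?L" "vnorm ?L (w n) \<le> M + vnorm ?L l" for n
      using norm_diff_le[OF y lL, of "k n"] M[of "k n"] y lL by (auto simp: w_def)
    moreover have "(\<lambda>n. w n i) \<longlonglongrightarrow> 0" for i
      unfolding w_eq using tendsto_diff[OF l tendsto_const[of "l i"], of i] by simp
    ultimately obtain s where s: "strict_mono s" "weakly_p_summable p ?L (\<lambda>n. w (s n))"
      using gliding_hump[OF p pq q, of w "M + vnorm ?L l"] by blast
    show ?thesis
    proof (intro exI conjI)
      show "strict_mono (k \<circ> s)" using k s(1) by (simp add: strict_mono_o)
      show "weakly_p_convergent p ?L (y \<circ> (k \<circ> s))"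
        unfolding weakly_p_convergent_def using y lL s(2) by (auto simp: w_def)
    qed
  qed
  then show ?thesis
    using banach_lp[OF q1, where 'k = 'k] by (auto simp: W_class_def)
qed

section \<open>Weakly limited sets and compactness\<close>

lemma finite_net_or_separated_sequence:
  obtains (net) F where "finite F" "F \<subseteq> S" "\<And>x. x \<in> S \<Longrightarrow> \<exists>y\<in>F. R x y"
  | (separated) s where "\<And>n::nat. s n \<in> S" "\<And>m n. m < n \<Longrightarrow> \<not> R (s n) (s m)"
proof (cases "\<exists>F. finite F \<and> F \<subseteq> S \<and> (\<forall>x\<in>S. \<exists>y\<in>F. R x y)")
  case True
  then show ?thesis using net by blast
next
  case False
  have "\<exists>s :: nat \<Rightarrow> _. \<forall>n. s n \<in> S \<and> (\<forall>m<n. \<not> R (s n) (s m))"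
  proof (rule dependent_wellorder_choice)
    fix n and s :: "nat \<Rightarrow> _"
    assume "\<And>m. m < n \<Longrightarrow> s m \<in> S \<and> (\<forall>k<m. \<not> R (s m) (s k))"
    then have "finite (s ` {..<n})" "s ` {..<n} \<subseteq> S" by auto
    then have "\<not> (\<forall>x\<in>S. \<exists>y\<in>s ` {..<n}. R x y)" using False by blast
    then show "\<exists>x. x \<in> S \<and> (\<forall>m<n. \<not> R x (s m))" by blast
  qed simp
  then show ?thesis using separated by blast
qed

text \<open>
  The two arguments of a function of two variables have the same compactness. If
  finitely many \<open>y\<close> approximate all others uniformly in \<open>f\<close>, then \<open>a f\<close> is determined up to a
  small error by its values at these \<open>y\<close>, and bounded families of finitely many scalars
  have convergent subsequences.
\<close>

lemma transpose_finite_nets: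
  fixes a :: "'f \<Rightarrow> 'y \<Rightarrow> 'k::{real_normed_field,heine_borel}"
  assumes bounded: "\<And>y. y \<in> B \<Longrightarrow> \<exists>M. \<forall>f\<in>K. norm (a f y) \<le> M"
    and net: "\<And>e. e > 0 \<Longrightarrow> \<exists>F. finite F \<and> F \<subseteq> B \<and> (\<forall>y\<in>B. \<exists>z\<in>F. \<forall>f\<in>K. norm (a f y - a f z) \<le> e)"
    and e: "e > 0"
  shows "\<exists>G. finite G \<and> G \<subseteq> K \<and> (\<forall>f\<in>K. \<exists>g\<in>G. \<forall>y\<in>B. norm (a f y - a g y) \<le> e)"
proof -
  have "e/3 > 0" using e by simp
  from net[OF this] obtain F where F: "finite F" "F \<subseteq> B"
    and F_net: "\<And>y. y \<in> B \<Longrightarrow> \<exists>z\<in>F. \<forall>f\<in>K. norm (a f y - a f z) \<le> e/3" by blast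
  show ?thesis
  proof (rule finite_net_or_separated_sequence[of K "\<lambda>f g. \<forall>z\<in>F. norm (a f z - a g z) \<le> e/3"])
    fix G assume G: "finite G" "G \<subseteq> K"
      and G_net: "\<And>f. f \<in> K \<Longrightarrow> \<exists>g\<in>G. \<forall>z\<in>F. norm (a f z - a g z) \<le> e/3"
    have "\<exists>g\<in>G. \<forall>y\<in>B. norm (a f y - a g y) \<le> e" if f: "f \<in> K" for f
    proof -
      obtain g where g: "g \<in> G" "\<And>z. z \<in> F \<Longrightarrow> norm (a f z - a g z) \<le> e/3"
        using G_net[OF f] by blast
      have "norm (a f y - a g y) \<le> e" if y: "y \<in> B" for y
      proof -
        obtain z where z: "z \<in> F" "\<And>f. f \<in> K \<Longrightarrow> norm (a f y - a f z) \<le> e/3"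
          using F_net[OF y] by blast
        have "a f y - a g y = (a f y - a f z) + (a f z - a g z) - (a g y - a g z)" by simp
        then have "norm (a f y - a g y) \<le> norm (a f y - a f z) + norm (a f z - a g z) + norm (a g y - a g z)"
          using norm_triangle_ineq4[of "(a f y - a f z) + (a f z - a g z)" "a g y - a g z"]
            norm_triangle_ineq[of "a f y - a f z" "a f z - a g z"] by simp
        then show ?thesis
          using z(2)[OF f] z(2)[of g] g(1) g(2)[OF z(1)] G(2) by auto
      qed
      then show ?thesis using g(1) by blast
    qed
    then show ?thesis using G by blast
  next
    fix s :: "nat \<Rightarrow> 'f"
    assume s: "\<And>n. s n \<in> K" and sep: "\<And>m n. m < n \<Longrightarrow> \<not> (\<forall>z\<in>F. norm (a (s n) z - a (s m) z) \<le> e/3)"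
    obtain M where M: "\<And>y f. y \<in> B \<Longrightarrow> f \<in> K \<Longrightarrow> norm (a f y) \<le> M y"
      using bounded by metis
    have "norm (a (s n) z) \<le> Max (insert 0 (M ` F))" if "z \<in> F" for n z
      by (rule order_trans[OF M[OF _ s] Max_ge]) (use that F in auto)
    then obtain k :: "nat \<Rightarrow> nat" where k: "strict_mono k"
      and conv: "\<And>z. z \<in> F \<Longrightarrow> \<exists>l. (\<lambda>n. a (s (k n)) z) \<longlonglongrightarrow> l"
      using function_convergent_subsequence[of F "\<lambda>n. a (s n)"] F(1) by (metis countable_finite)
    \<comment> \<open>consecutive members of a convergent sequence contradict the separation\<close>
    have "\<forall>\<^sub>F n in sequentially. norm (a (s (k (Suc n))) z - a (s (k n)) z) < e/3" if z: "z \<in> F" for z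
    proof -
      obtain l where l: "(\<lambda>n. a (s (k n)) z) \<longlonglongrightarrow> l" using conv[OF z] by blast
      have "(\<lambda>n. norm (a (s (k (Suc n))) z - a (s (k n)) z)) \<longlonglongrightarrow> 0"
        using tendsto_diff[OF LIMSEQ_Suc[OF l] l] by (simp add: tendsto_norm_zero)
      then show ?thesis using e by (intro order_tendstoD(2)) auto
    qed
    then have "\<forall>\<^sub>F n in sequentially. \<forall>z\<in>F. norm (a (s (k (Suc n))) z - a (s (k n)) z) < e/3"
      using F(1) by (simp add: eventually_ball_finite)
    then obtain n where "\<forall>z\<in>F. norm (a (s (k (Suc n))) z - a (s (k n)) z) < e/3"
      by (auto simp: eventually_sequentially)
    moreover have "k n < k (Suc n)" using k by (simp add: strict_monoD)
    ultimately show ?thesis using sep[of "k n" "k (Suc n)"] by (auto intro: less_imp_le)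
  qed
qed

lemma SUP_ennreal_tendsto_0_iff:
  fixes h :: "'f \<Rightarrow> nat \<Rightarrow> 'k::real_normed_vector"
  shows "(\<lambda>n. SUP f\<in>K. ennreal (norm (h f n))) \<longlonglongrightarrow> 0 \<longleftrightarrow>
    (\<forall>e>0. \<forall>\<^sub>F n in sequentially. \<forall>f\<in>K. norm (h f n) \<le> e)"
proof (intro iffI allI impI)
  fix e :: real assume L: "(\<lambda>n. SUP f\<in>K. ennreal (norm (h f n))) \<longlonglongrightarrow> 0" and e: "e > 0"
  have "\<forall>\<^sub>F n in sequentially. (SUP f\<in>K. ennreal (norm (h f n))) < ennreal e"
    using e by (intro order_tendstoD(2)[OF L]) simp
  then show "\<forall>\<^sub>F n in sequentially. \<forall>f\<in>K. norm (h f n) \<le> e"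
  proof eventually_elim
    case (elim n)
    show ?case
    proof
      fix f assume "f \<in> K"
      then have "ennreal (norm (h f n)) \<le> (SUP f\<in>K. ennreal (norm (h f n)))"
        by (rule SUP_upper)
      then have "ennreal (norm (h f n)) \<le> ennreal e" using elim by simp
      then show "norm (h f n) \<le> e" using e by (simp add: ennreal_le_iff)
    qed
  qed
next
  assume R: "\<forall>e>0. \<forall>\<^sub>F n in sequentially. \<forall>f\<in>K. norm (h f n) \<le> e"
  show "(\<lambda>n. SUP f\<in>K. ennreal (norm (h f n))) \<longlonglongrightarrow> 0"
  proof (rule order_tendstoI)
    fix c :: ennreal assume "0 < c"
    then obtain d where d: "0 < d" "d < c" using dense by blast
    then obtain e where e: "d = ennreal e" "0 \<le> e" by (cases d) auto
    have "\<forall>\<^sub>F n in sequentially. \<forall>f\<in>K. norm (h f n) \<le> e"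
      using R d(1) e by (auto simp: less_le)
    then show "\<forall>\<^sub>F n in sequentially. (SUP f\<in>K. ennreal (norm (h f n))) < c"
    proof eventually_elim
      case (elim n)
      then have "(SUP f\<in>K. ennreal (norm (h f n))) \<le> d"
        unfolding e(1) by (intro SUP_least ennreal_leI) auto
      then show ?case using d(2) by simp
    qed
  qed auto
qed

lemma weakly_p_limitedD:
  assumes "weakly_p_limited p X K" "weakly_p_summable p X x" "e > 0"
  shows "\<forall>\<^sub>F n in sequentially. \<forall>f\<in>K. norm (f (x n)) \<le> e"
  using assms SUP_ennreal_tendsto_0_iff[of "\<lambda>f n. f (x n)" K] by (auto simp: weakly_p_limited_def)

lemma (in nspace_pair) adjoint_map_in:
  assumes T: "operator V W T" and f: "f \<in> carrier (dual_space W)"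
  shows "adjoint_map V T f \<in> carrier (dual_space V)"
proof -
  have lin: "linear_map V W T" using T by (rule operator_linear)
  obtain C where C: "\<And>y. y \<in> carrier V \<Longrightarrow> vnorm W (T y) \<le> C * vnorm V y"
    using T by (auto simp: operator_iff)
  have "norm (f (T y)) \<le> (vnorm (dual_space W) f * C) * vnorm V y" if "y \<in> carrier V" for y
    using W.dual_norm_bound[OF f linear_map_in[OF lin that]]
      mult_left_mono[OF C[OF that] W.dual_norm_nonneg[OF f]] by simp
  moreover have "linear_map V scalar_space (adjoint_map V T f)"
    using lin W.dual_linear[OF f] by (auto simp: adjoint_map_def compose_def linear_map_def Pi_iff)
  ultimately show ?thesis
    by (auto simp: V.dual_carrier_iff' adjoint_map_def compose_def)
qed

lemma adjoint_map_apply: "y \<in> carrier V \<Longrightarrow> adjoint_map V T f y = f (T y)"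
  by (simp add: adjoint_map_def compose_def)

text \<open>
  If the unit ball of \<open>Y\<close> had no finite net for the distance
  \<open>sup {\<bar>f (T y) - f (T z)\<bar> | f. f \<in> K}\<close>, it would contain a sequence separated for it. A
  subsequence is weakly \<open>p\<close>-convergent, so that \<open>K\<close> being weakly \<open>p\<close>-limited brings its members close
  to each other. Transposition turns finite nets for the ball into finite nets for \<open>T\<^sup>*(K)\<close>.
\<close>

theorem weakly_p_limited_imp_relatively_compact:
  fixes X :: "('k::{real_normed_field,heine_borel}, 'x) normed_module" and Y :: "('k, 'y) normed_module"
  assumes X: "nspace X" and p: "1 < p" and K: "weakly_p_limited p X K"
    and Y: "Y \<in> W_class p" and T: "operator Y X T"
  shows "relatively_compact (dual_space Y) (adjoint_map Y T ` K)"
proof -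
  interpret nspace_pair Y X
    using X Y by (auto simp: nspace_pair_def W_class_def banach_space_def nspace_def)
  interpret dual: nspace "dual_space Y" by (rule V.nspace_dual)
  interpret dualX: nspace "dual_space X" by (rule W.nspace_dual)
  have p0: "0 < p" using p by simp
  have lin: "linear_map Y X T" using T by (rule operator_linear)
  have KX: "f \<in> carrier (dual_space X)" if "f \<in> K" for f
    using K that by (auto simp: weakly_p_limited_def)
  have "\<exists>M. \<forall>f\<in>K. vnorm (dual_space X) f \<le> M"
    using K unfolding weakly_p_limited_def dualX.norm_bounded_iff by blast
  then obtain M where M: "\<And>f. f \<in> K \<Longrightarrow> vnorm (dual_space X) f \<le> M" by blast
  let ?B = "closed_unit_ball Y"
  have bounded: "\<exists>M. \<forall>f\<in>K. norm (f (T y)) \<le> M" if "y \<in> ?B" for y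
  proof (intro exI[of _ "M * vnorm X (T y)"] ballI)
    fix f assume f: "f \<in> K"
    have Ty: "T y \<in> carrier X" using that lin by (auto simp: closed_unit_ball_def linear_map_in)
    show "norm (f (T y)) \<le> M * vnorm X (T y)"
      using W.dual_norm_bound[OF KX[OF f] Ty] mult_right_mono[OF M[OF f] W.norm_nonneg[OF Ty]] by simp
  qed
  have net: "\<exists>F. finite F \<and> F \<subseteq> ?B \<and> (\<forall>y\<in>?B. \<exists>z\<in>F. \<forall>f\<in>K. norm (f (T y) - f (T z)) \<le> e)"
    if e: "e > 0" for e
  proof (rule finite_net_or_separated_sequence[of ?B "\<lambda>y z. \<forall>f\<in>K. norm (f (T y) - f (T z)) \<le> e"])
    fix y :: "nat \<Rightarrow> 'y"
    assume y: "\<And>n. y n \<in> ?B"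
      and sep: "\<And>m n. m < n \<Longrightarrow> \<not> (\<forall>f\<in>K. norm (f (T (y n)) - f (T (y m))) \<le> e)"
    have yY: "y n \<in> carrier Y" for n using y[of n] by (simp add: closed_unit_ball_def)
    have "range y \<subseteq> carrier Y \<and> norm_bounded Y (range y)"
      using y by (auto simp: V.norm_bounded_iff closed_unit_ball_def)
    then obtain r :: "nat \<Rightarrow> nat" where r: "strict_mono r" "weakly_p_convergent p Y (y \<circ> r)"
      using Y by (auto simp: W_class_def)
    then obtain l where l: "l \<in> carrier Y" "weakly_p_summable p Y (\<lambda>n. y (r n) \<ominus>\<^bsub>Y\<^esub> l)"
      by (auto simp: weakly_p_convergent_def)
    have "weakly_p_summable p X (\<lambda>n. T (y (r n) \<ominus>\<^bsub>Y\<^esub> l))"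
      by (rule weakly_p_summable_image[OF p0 T l(2)])
    then have "\<forall>\<^sub>F n in sequentially. \<forall>f\<in>K. norm (f (T (y (r n) \<ominus>\<^bsub>Y\<^esub> l))) \<le> e/2"
      using e by (intro weakly_p_limitedD[OF K]) auto
    then obtain n where n: "\<And>m f. n \<le> m \<Longrightarrow> f \<in> K \<Longrightarrow> norm (f (T (y (r m) \<ominus>\<^bsub>Y\<^esub> l))) \<le> e/2"
      by (auto simp: eventually_sequentially)
    have "norm (f (T (y (r (Suc n)))) - f (T (y (r n)))) \<le> e" if f: "f \<in> K" for f
    proof -
      have "f (T (y m \<ominus>\<^bsub>Y\<^esub> l)) = f (T (y m)) - f (T l)" for m
        using yY l(1) lin KX[OF f] by (simp add: linear_map_diff linear_map_in W.dual_diff)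
      then have "f (T (y (r (Suc n)))) - f (T (y (r n))) =
          f (T (y (r (Suc n)) \<ominus>\<^bsub>Y\<^esub> l)) - f (T (y (r n) \<ominus>\<^bsub>Y\<^esub> l))" by simp
      then show ?thesis
        using norm_triangle_ineq4[of "f (T (y (r (Suc n)) \<ominus>\<^bsub>Y\<^esub> l))" "f (T (y (r n) \<ominus>\<^bsub>Y\<^esub> l))"]
          n[OF _ f, of n] n[OF _ f, of "Suc n"] by simp
    qed
    then have "\<forall>f\<in>K. norm (f (T (y (r (Suc n)))) - f (T (y (r n)))) \<le> e" by blast
    moreover have "r n < r (Suc n)" using r(1) by (simp add: strict_monoD)
    ultimately show ?thesis using sep[of "r n" "r (Suc n)"] by simp
  qed blast
  have "dual.met.mtotally_bounded (adjoint_map Y T ` K)"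
    unfolding dual.met.mtotally_bounded_def
  proof (intro allI impI)
    fix e :: real assume e: "e > 0"
    then have "e/2 > 0" by simp
    from transpose_finite_nets[OF bounded net this] obtain G where G: "finite G" "G \<subseteq> K"
      and G_net: "\<And>f. f \<in> K \<Longrightarrow> \<exists>g\<in>G. \<forall>y\<in>?B. norm (f (T y) - g (T y)) \<le> e/2" by blast
    have "adjoint_map Y T f \<in> (\<Union>h\<in>adjoint_map Y T ` G. dual.met.mball h e)" if f: "f \<in> K" for f
    proof -
      obtain g where g: "g \<in> G" "\<And>y. y \<in> ?B \<Longrightarrow> norm (f (T y) - g (T y)) \<le> e/2"
        using G_net[OF f] by blast
      have in_dual: "adjoint_map Y T f \<in> carrier (dual_space Y)" "adjoint_map Y T g \<in> carrier (dual_space Y)"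
        using adjoint_map_in[OF T KX] f g(1) G(2) by auto
      have "vdist (dual_space Y) (adjoint_map Y T f) (adjoint_map Y T g) \<le> e/2"
        using g(2) e in_dual by (intro V.vdist_dual_le) (auto simp: closed_unit_ball_def adjoint_map_apply)
      then show ?thesis
        using in_dual g(1) e by (auto simp: dual.met.commute)
    qed
    then show "\<exists>H. finite H \<and> H \<subseteq> adjoint_map Y T ` K \<and> adjoint_map Y T ` K \<subseteq> (\<Union>h\<in>H. dual.met.mball h e)"
      using G by (intro exI[of _ "adjoint_map Y T ` G"]) auto
  qed
  then show ?thesis
    by (simp add: relatively_compact_dual_iff V.nspace_axioms)
qed

text \<open>
  A weakly null sequence tends to zero uniformly on each finite net of \<open>T\<^sup>*(K)\<close>; boundedness of the
  sequence extends this, up to the mesh of the net, to the whole set.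
\<close>

lemma relatively_compact_adjoint_imp_uniform:
  fixes X :: "('k::{real_normed_field,heine_borel}, 'x) normed_module" and Y :: "('k, 'y) normed_module"
  assumes Y: "nspace Y" and X: "nspace X" and T: "operator Y X T" and p: "0 < p"
    and K: "K \<subseteq> carrier (dual_space X)"
    and rc: "relatively_compact (dual_space Y) (adjoint_map Y T ` K)"
    and y: "weakly_p_summable p Y y" "\<And>n. vnorm Y (y n) \<le> M" and e: "e > 0"
  shows "\<forall>\<^sub>F n in sequentially. \<forall>f\<in>K. norm (f (T (y n))) \<le> e"
proof -
  interpret nspace_pair Y X using X Y by (simp add: nspace_pair_def)
  interpret dual: nspace "dual_space Y" by (rule V.nspace_dual)
  have yY: "y n \<in> carrier Y" for n by (rule V.weakly_p_summable_in[OF y(1)])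
  have M: "0 \<le> M" using V.norm_nonneg[OF yY] y(2) order_trans by blast
  \<comment> \<open>\<open>M + 1\<close> since \<open>M\<close> may be zero\<close>
  define d where "d = e / (2 * (M + 1))"
  have d: "d > 0" "d * M \<le> e/2" using e M by (auto simp: d_def field_simps)
  have "dual.met.mtotally_bounded (adjoint_map Y T ` K)"
    using rc by (simp add: relatively_compact_dual_iff Y)
  from this[unfolded dual.met.mtotally_bounded_def, rule_format, OF d(1)]
  obtain G where G: "finite G" "G \<subseteq> adjoint_map Y T ` K"
    "adjoint_map Y T ` K \<subseteq> (\<Union>g\<in>G. dual.met.mball g d)"
    by blast
  have "\<forall>\<^sub>F n in sequentially. norm (g (y n)) < e/2" if "g \<in> G" for g
  proof -
    have "g \<in> carrier (dual_space Y)" using G(2) that adjoint_map_in[OF T] K by auto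
    then have "(\<lambda>n. norm (g (y n))) \<longlonglongrightarrow> 0"
      by (intro tendsto_norm_zero V.weakly_p_summable_tendsto_0[OF p y(1)])
    then show ?thesis using e by (intro order_tendstoD(2)) auto
  qed
  then have "\<forall>\<^sub>F n in sequentially. \<forall>g\<in>G. norm (g (y n)) < e/2"
    using G(1) by (simp add: eventually_ball_finite)
  then show ?thesis
  proof eventually_elim
    case (elim n)
    show ?case
    proof
      fix f assume f: "f \<in> K"
      let ?f = "adjoint_map Y T f"
      obtain g where g: "g \<in> G" "g \<in> carrier (dual_space Y)" "?f \<in> carrier (dual_space Y)"
        "vdist (dual_space Y) g ?f < d"
        using G(3) f by auto
      have "norm (g (y n) - ?f (y n)) \<le> vdist (dual_space Y) g ?f * vnorm Y (y n)"
        by (rule V.vdist_dual_bound[OF g(2,3) yY])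
      also have "\<dots> \<le> d * M"
        using g(4) y(2) yY d(1) by (intro mult_mono) auto
      finally have "norm (g (y n) - ?f (y n)) \<le> e/2" using d(2) by simp
      moreover have "norm (g (y n)) < e/2" using elim g(1) by blast
      ultimately have "norm (?f (y n)) \<le> e"
        using norm_triangle_ineq4[of "g (y n)" "g (y n) - ?f (y n)"] by simp
      then show "norm (f (T (y n))) \<le> e"
        using yY by (simp add: adjoint_map_apply)
    qed
  qed
qed

section \<open>Operators given by weakly summable sequences\<close>

lemma (in nspace) norm_le_by_functionals:
  assumes "has_norming_functionals V" "y \<in> carrier V"
    "\<And>f. f \<in> closed_unit_ball (dual_space V) \<Longrightarrow> norm (f y) \<le> D"
  shows "vnorm V y \<le> D"
  using assms unfolding has_norming_functionals_def by force

lemma (in nspace) eq_by_functionals: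
  assumes "has_norming_functionals V" "y \<in> carrier V" "z \<in> carrier V"
    "\<And>f. f \<in> closed_unit_ball (dual_space V) \<Longrightarrow> f y = f z"
  shows "y = z"
proof -
  have "vnorm V (y \<ominus> z) \<le> 0"
    using assms by (intro norm_le_by_functionals) (auto simp: dual_diff closed_unit_ball_def)
  then have "vdist V y z = 0"
    using assms(2,3) by (simp add: vdist_def order_antisym)
  then show ?thesis
    using assms(2,3) met.zero by blast
qed

text \<open>
  The operator sends \<open>a\<close> to the sum of the series \<open>\<Sum>n. a\<^sub>n x\<^sub>n\<close>, which Hoelder's inequality makes
  Cauchy once norms are computed by functionals. The sum is described by its values under
  functionals, so that linearity and boundedness are statements about scalar series.
\<close>

theorem operator_of_weakly_p_summable:
  fixes X :: "('k::real_normed_field, 'x) normed_module"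
  assumes p: "1 < p" and pq: "1 / p + 1 / q = 1" and q: "1 < q"
    and X: "banach_space X" and norming: "has_norming_functionals X"
    and x: "weakly_p_summable p X x"
  obtains T where "operator (lp_space q) X T"
    "\<And>n. T (\<lambda>i. if i = n then 1 else 0) = x n"
proof -
  let ?L = "lp_space q :: ('k, _) normed_module"
  interpret nspace_pair ?L X
    using X q by (intro nspace_pair.intro nspace_lp) (auto simp: banach_space_def nspace_def)
  have p0: "0 < p" and q0: "0 < q" and q1: "1 \<le> q" using p q by auto
  let ?B = "closed_unit_ball (dual_space X)"
  have B: "f \<in> carrier (dual_space X)" if "f \<in> ?B" for f
    using that by (simp add: closed_unit_ball_def)
  have xX: "x n \<in> carrier X" for n by (rule W.weakly_p_summable_in[OF x])
  obtain C where C: "0 \<le> C"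
    "\<And>f N. f \<in> ?B \<Longrightarrow> (\<Sum>n<N. norm (f (x n)) powr p) \<le> C powr p"
    using x unfolding W.weakly_p_summable_iff[OF p0] by blast
  have Hoelder: "norm (\<Sum>k=m..<n. a k * f (x k)) \<le> C * \<beta>"
    if f: "f \<in> ?B" and \<beta>: "0 \<le> \<beta>" "(\<Sum>k=m..<n. norm (a k) powr q) \<le> \<beta> powr q" for f a m n \<beta>
  proof -
    have "norm (\<Sum>k=m..<n. a k * f (x k)) \<le> (\<Sum>k=m..<n. norm (f (x k)) * norm (a k))"
      by (rule sum_norm_le) (simp add: norm_mult mult.commute)
    also have "\<dots> \<le> C * \<beta>"
    proof (rule Hoelder_sum[OF p pq])
      have "(\<Sum>k=m..<n. norm (f (x k)) powr p) \<le> (\<Sum>k<n. norm (f (x k)) powr p)"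
        by (intro sum_mono2) auto
      then show "(\<Sum>k=m..<n. norm (f (x k)) powr p) \<le> C powr p"
        using C(2)[OF f, of n] by simp
    qed (use \<beta> C(1) in auto)
    finally show ?thesis .
  qed
  define is_sum where "is_sum = (\<lambda>a y. y \<in> carrier X \<and> (\<forall>f\<in>?B. (\<lambda>k. a k * f (x k)) sums f y))"
  have unique: "y = z" if "is_sum a y" "is_sum a z" for a y z
    using that by (intro W.eq_by_functionals[OF norming]) (auto simp: is_sum_def intro: sums_unique2)
  have ex: "\<exists>y. is_sum a y" if a: "a \<in> carrier ?L" for a
  proof -
    let ?S = "lin_comb X a x"
    have S: "?S n \<in> carrier X" for n by (rule W.lin_comb_in[OF xX])
    have diff: "f (?S n \<ominus>\<^bsub>X\<^esub> ?S m) = (\<Sum>k=m..<n. a k * f (x k))" if "m \<le> n" "f \<in> ?B" for f m n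
      using that S xX B
      by (simp add: W.dual_diff W.dual_lin_comb lessThan_atLeast0 algebra_simps
          sum.atLeastLessThan_concat[of 0 m n "\<lambda>k. a k * f (x k)", symmetric])
    have "\<exists>N. \<forall>m\<ge>N. \<forall>n\<ge>m. vnorm X (?S n \<ominus>\<^bsub>X\<^esub> ?S m) < e" if e: "e > 0" for e
    proof -
      define d where "d = e / (C + 1)"
      have d: "d > 0" "C * d < e" using e C(1) by (auto simp: d_def field_simps)
      have "d powr q > 0" using d by simp
      then obtain N where N: "\<And>m n. m \<ge> N \<Longrightarrow> norm (\<Sum>k=m..<n. norm (a k) powr q) < d powr q"
        using a unfolding lp_carrier summable_Cauchy by meson
      have "vnorm X (?S n \<ominus>\<^bsub>X\<^esub> ?S m) < e" if "N \<le> m" "m \<le> n" for m n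
      proof -
        have "(\<Sum>k=m..<n. norm (a k) powr q) \<le> d powr q" using N[OF that(1), of n] by simp
        then have "vnorm X (?S n \<ominus>\<^bsub>X\<^esub> ?S m) \<le> C * d"
          using d(1) S that(2)
          by (intro W.norm_le_by_functionals[OF norming]) (auto simp: diff intro!: Hoelder)
        then show ?thesis using d(2) by simp
      qed
      then show ?thesis by blast
    qed
    then have "\<exists>N. \<forall>m n. N \<le> m \<longrightarrow> N \<le> n \<longrightarrow> vdist X (?S m) (?S n) < e" if "e > 0" for e
      using S that by (simp add: vdist_def) (metis W.norm_diff_commute nat_le_linear)
    then have "W.met.MCauchy ?S"
      using S by (auto simp: W.met.MCauchy_def)
    then obtain y where y: "limitin W.met.mtopology ?S y sequentially"
      using X unfolding banach_space_def W.met.mcomplete_def by blast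
    have yX: "y \<in> carrier X" using y W.met.limitin_mspace by blast
    have dist: "(\<lambda>n. vdist X (?S n) y) \<longlonglongrightarrow> 0"
      using y by (simp add: W.met.limitin_metric_dist_null)
    have "(\<lambda>k. a k * f (x k)) sums f y" if f: "f \<in> ?B" for f
    proof -
      have "norm (f (?S n) - f y) \<le> vdist X (?S n) y" for n
        using f S yX by (simp add: vdist_def W.dual_diff[OF B[OF f], symmetric] W.dual_ball_iff)
      then have "(\<lambda>n. f (?S n) - f y) \<longlonglongrightarrow> 0"
        by (intro Lim_null_comparison[OF _ dist]) auto
      then have "(\<lambda>n. f (?S n)) \<longlonglongrightarrow> f y" by (rule LIM_zero_cancel)
      then show ?thesis using B[OF f] xX by (simp add: sums_def W.dual_lin_comb)
    qed
    then show ?thesis using yX by (auto simp: is_sum_def)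
  qed
  define T where "T = (\<lambda>a. SOME y. is_sum a y)"
  have T: "is_sum a (T a)" if "a \<in> carrier ?L" for a
    unfolding T_def using ex[OF that] by (rule someI_ex)
  have TX: "T a \<in> carrier X" if "a \<in> carrier ?L" for a
    using T[OF that] by (simp add: is_sum_def)
  have "T (a \<oplus>\<^bsub>?L\<^esub> b) = T a \<oplus>\<^bsub>X\<^esub> T b" if a: "a \<in> carrier ?L" and b: "b \<in> carrier ?L" for a b
  proof (rule unique)
    show "is_sum (a \<oplus>\<^bsub>?L\<^esub> b) (T (a \<oplus>\<^bsub>?L\<^esub> b))" using a b by (intro T) blast
    show "is_sum (a \<oplus>\<^bsub>?L\<^esub> b) (T a \<oplus>\<^bsub>X\<^esub> T b)"
      using T[OF a] T[OF b] B by (auto simp: is_sum_def W.dual_add distrib_right intro: sums_add)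
  qed
  moreover have "T (c \<odot>\<^bsub>?L\<^esub> a) = c \<odot>\<^bsub>X\<^esub> T a" if a: "a \<in> carrier ?L" for c a
  proof (rule unique)
    show "is_sum (c \<odot>\<^bsub>?L\<^esub> a) (T (c \<odot>\<^bsub>?L\<^esub> a))" using a by (intro T) blast
    show "is_sum (c \<odot>\<^bsub>?L\<^esub> a) (c \<odot>\<^bsub>X\<^esub> T a)"
      using T[OF a] B by (auto simp: is_sum_def W.dual_smult mult.assoc intro: sums_mult)
  qed
  ultimately have "linear_map ?L X T"
    using TX unfolding linear_map_def by blast
  moreover have "vnorm X (T a) \<le> C * vnorm ?L a" if a: "a \<in> carrier ?L" for a
  proof (rule W.norm_le_by_functionals[OF norming TX[OF a]])
    fix f assume f: "f \<in> ?B"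
    have "(\<lambda>n. \<Sum>k<n. a k * f (x k)) \<longlonglongrightarrow> f (T a)"
      using T[OF a] f by (simp add: is_sum_def sums_def)
    moreover have "norm (\<Sum>k<n. a k * f (x k)) \<le> C * vnorm ?L a" for n
      unfolding lessThan_atLeast0
      by (intro Hoelder f lp_norm_nonneg lp_partial_sum q0 a) auto
    ultimately show "norm (f (T a)) \<le> C * vnorm ?L a"
      by (intro tendsto_upperbound[OF tendsto_norm]) auto
  qed
  ultimately have op: "operator ?L X T"
    unfolding operator_iff by blast
  have "T (\<lambda>i. if i = n then 1 else 0) = x n" for n
  proof (rule unique)
    let ?e = "\<lambda>i. if i = n then 1 else 0 :: 'k"
    have "?e \<in> carrier ?L"
      using V.weakly_p_summable_in[OF lp_weakly_p_summable_unit_vectors[OF p pq q], of n] by simp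
    then show "is_sum ?e (T ?e)" by (rule T)
    have "?e k * f (x k) = (if k = n then f (x k) else 0)" for f k by simp
    then have "(\<lambda>k. ?e k * f (x k)) sums f (x n)" for f
      using sums_single[of n "\<lambda>k. f (x k)"] by presburger
    then show "is_sum ?e (x n)" using xX by (simp add: is_sum_def)
  qed
  with op show thesis by (rule that)
qed

lemma operator_compose:
  assumes "operator U V S" "operator V W T"
  shows "operator U W (\<lambda>u. T (S u))"
  using assms continuous_map_compose[of "norm_topology U" "norm_topology V" S "norm_topology W" T]
  by (auto simp: operator_def o_def Pi_iff)

section \<open>Copies of a normed space\<close>

text \<open>
  A copy of \<open>V\<close> with another type of vectors, along a map that is injective on the carrier. It moves
  a space of sequences into the type over which the spaces \<open>Y\<close> range.
\<close>

definition transport :: "('v \<Rightarrow> 'w) \<Rightarrow> ('k, 'v) normed_module \<Rightarrow> ('k, 'w) normed_module" where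
  "transport \<phi> V = (let \<psi> = inv_into (carrier V) \<phi> in
    \<lparr>carrier = \<phi> ` carrier V, monoid.mult = undefined, one = undefined,
     zero = \<phi> \<zero>\<^bsub>V\<^esub>, add = (\<lambda>a b. \<phi> (\<psi> a \<oplus>\<^bsub>V\<^esub> \<psi> b)), smult = (\<lambda>c a. \<phi> (c \<odot>\<^bsub>V\<^esub> \<psi> a)),
     vnorm = (\<lambda>a. vnorm V (\<psi> a))\<rparr>)"

locale isometric_copy = V: nspace V
  for V :: "('k::real_normed_field, 'v) normed_module" and \<phi> :: "'v \<Rightarrow> 'w" +
  assumes inj: "inj_on \<phi> (carrier V)"
begin

abbreviation "W \<equiv> transport \<phi> V"

abbreviation "\<psi> \<equiv> inv_into (carrier V) \<phi>"

lemma transport_simps [simp]: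
  "carrier W = \<phi> ` carrier V" "ring.zero W = \<phi> \<zero>\<^bsub>V\<^esub>"
  "ring.add W = (\<lambda>a b. \<phi> (\<psi> a \<oplus>\<^bsub>V\<^esub> \<psi> b))" "smult W = (\<lambda>c a. \<phi> (c \<odot>\<^bsub>V\<^esub> \<psi> a))"
  "vnorm W = (\<lambda>a. vnorm V (\<psi> a))"
  by (simp_all add: transport_def Let_def)

lemma inv_phi [simp]: "x \<in> carrier V \<Longrightarrow> \<psi> (\<phi> x) = x"
  by (rule inv_into_f_f[OF inj])

lemma nspace_transport: "nspace W"
proof
  have "abelian_group W"
  proof (rule abelian_groupI)
    fix a assume "a \<in> carrier W"
    then obtain x where x: "x \<in> carrier V" "a = \<phi> x" by auto
    then show "\<exists>b\<in>carrier W. b \<oplus>\<^bsub>W\<^esub> a = \<zero>\<^bsub>W\<^esub>"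
      by (intro bexI[of _ "\<phi> (\<ominus>\<^bsub>V\<^esub> x)"]) (auto simp: V.mod.M.l_neg)
  qed (auto simp: V.mod.M.a_ac)
  then have "Module.module scalars W"
    by (intro moduleI cring_scalars)
      (auto simp: V.smult_add_left V.smult_add_right V.smult_smult)
  then show "normed_space W"
    using inj_on_eq_iff[OF inj] by (auto simp: normed_space_def V.norm_add V.norm_smult)
qed

sublocale nspace_pair V W
  by (intro nspace_pair.intro V.nspace_axioms nspace_transport)

sublocale bwd: nspace_pair W V
  by (intro nspace_pair.intro V.nspace_axioms nspace_transport)

lemma operator_phi: "operator V W \<phi>"
  by (auto simp: operator_iff linear_map_def intro!: exI[of _ 1])

lemma operator_psi: "operator W V \<psi>"
  by (auto simp: bwd.operator_iff linear_map_def intro!: exI[of _ 1])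

lemma vdist_phi: "x \<in> carrier V \<Longrightarrow> y \<in> carrier V \<Longrightarrow> vdist W (\<phi> x) (\<phi> y) = vdist V x y"
  by (simp add: vdist_def linear_map_diff[OF operator_linear[OF operator_phi], symmetric])

lemma banach_transport:
  assumes "banach_space V"
  shows "banach_space W"
proof -
  have "W.met.mcomplete"
    unfolding W.met.mcomplete_def
  proof (intro allI impI)
    fix \<sigma> assume MC: "W.met.MCauchy \<sigma>"
    define \<tau> where "\<tau> = (\<lambda>n. \<psi> (\<sigma> n))"
    have "\<sigma> n \<in> \<phi> ` carrier V" for n using MC unfolding W.met.MCauchy_def by auto
    then have \<tau>: "\<tau> n \<in> carrier V" "\<sigma> n = \<phi> (\<tau> n)" for n
      by (auto simp: \<tau>_def f_inv_into_f inv_into_into)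
    have "V.met.MCauchy \<tau>"
      using MC \<tau>(1) unfolding V.met.MCauchy_def W.met.MCauchy_def by (simp add: \<tau>(2) vdist_phi image_subset_iff)
    then obtain y where "limitin V.met.mtopology \<tau> y sequentially"
      using assms by (auto simp: banach_space_def V.met.mcomplete_def)
    then have "limitin W.met.mtopology \<sigma> (\<phi> y) sequentially"
      using \<tau>(1) unfolding V.met.limit_metric_sequentially W.met.limit_metric_sequentially
      by (simp add: \<tau>(2) vdist_phi)
    then show "\<exists>z. limitin W.met.mtopology \<sigma> z sequentially" by blast
  qed
  then show ?thesis using W.normed by (simp add: banach_space_def)
qed

lemma W_class_transport:
  assumes p: "0 < p" and V: "V \<in> W_class p"
  shows "W \<in> W_class p"
proof -
  have "\<exists>r. strict_mono r \<and> weakly_p_convergent p W (y \<circ> r)"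
    if bounded: "range y \<subseteq> carrier W \<and> norm_bounded W (range y)" for y :: "nat \<Rightarrow> 'w"
  proof -
    define x where "x = (\<lambda>n. \<psi> (y n))"
    have "y n \<in> \<phi> ` carrier V" for n using bounded by auto
    then have x: "x n \<in> carrier V" "y n = \<phi> (x n)" for n
      by (auto simp: x_def f_inv_into_f inv_into_into)
    have "range x \<subseteq> carrier V \<and> norm_bounded V (range x)"
      using bounded x by (auto simp: V.norm_bounded_iff W.norm_bounded_iff)
    then obtain r :: "nat \<Rightarrow> nat" where r: "strict_mono r" "weakly_p_convergent p V (x \<circ> r)"
      using V unfolding W_class_def by blast
    then obtain l where l: "l \<in> carrier V" "weakly_p_summable p V (\<lambda>n. x (r n) \<ominus>\<^bsub>V\<^esub> l)"
      by (auto simp: weakly_p_convergent_def)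
    have "weakly_p_summable p W (\<lambda>n. \<phi> (x (r n) \<ominus>\<^bsub>V\<^esub> l))"
      by (rule weakly_p_summable_image[OF p operator_phi l(2)])
    then have "weakly_p_summable p W (\<lambda>n. y (r n) \<ominus>\<^bsub>W\<^esub> \<phi> l)"
      using linear_map_diff[OF operator_linear[OF operator_phi]] x l(1) by simp
    then have "weakly_p_convergent p W (y \<circ> r)"
      using x l(1) by (auto simp: weakly_p_convergent_def)
    then show ?thesis using r(1) by blast
  qed
  then show ?thesis
    using banach_transport V by (auto simp: W_class_def)
qed

end

section \<open>The characterizations\<close>

text \<open>
  A weakly \<open>p\<close>-summable sequence is the image of the unit vectors under an operator from \<open>l\<^sub>q\<close>, and
  the unit vectors are themselves weakly \<open>p\<close>-summable. The space \<open>Y\<close> is \<open>l\<^sub>q\<close> or a copy of it.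
\<close>

lemma weakly_p_limited_if_all_adjoints_compact:
  fixes X :: "('k::{real_normed_field,heine_borel}, 'x) normed_module"
  assumes p: "1 < p" and pq: "1 / p + 1 / q = 1" and q: "1 < q"
    and X: "banach_space X" "has_norming_functionals X"
    and K: "K \<subseteq> carrier (dual_space X)" "norm_bounded (dual_space X) K"
    and Y: "nspace Y"
    and \<phi>: "operator (lp_space q) Y \<phi>" and \<psi>: "operator Y (lp_space q) \<psi>"
    and inverse: "\<And>a. a \<in> carrier (lp_space q) \<Longrightarrow> \<psi> (\<phi> a) = a"
    and rc: "\<And>T. operator Y X T \<Longrightarrow> relatively_compact (dual_space Y) (adjoint_map Y T ` K)"
  shows "weakly_p_limited p X K"
proof -
  let ?L = "lp_space q :: ('k, _) normed_module"
  have p0: "0 < p" using p by simp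
  interpret nspace_pair ?L Y
    using q Y by (intro nspace_pair.intro nspace_lp) auto
  have nX: "nspace X" using X by (simp add: nspace_def banach_space_def)
  let ?e = "\<lambda>n i. if i = n then 1 else 0 :: 'k"
  have e: "weakly_p_summable p ?L ?e" by (rule lp_weakly_p_summable_unit_vectors[OF p pq q])
  have e_L: "?e n \<in> carrier ?L" for n using V.weakly_p_summable_in[OF e] .
  have e_norm: "vnorm ?L (?e n) \<le> 1" for n
  proof (rule lpI)
    have "norm (?e n i) powr q = (if i = n then 1 else 0)" for i using q by simp
    then show "(\<Sum>i<N. norm (?e n i) powr q) \<le> 1 powr q" for N by simp
  qed (use q in auto)
  obtain C where C: "\<And>a. a \<in> carrier ?L \<Longrightarrow> vnorm Y (\<phi> a) \<le> C * vnorm ?L a"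
    using \<phi> by (auto simp: operator_iff)
  have \<phi>e_norm: "vnorm Y (\<phi> (?e n)) \<le> \<bar>C\<bar>" for n
    using order_trans[OF C[OF e_L] mult_mono[of C "\<bar>C\<bar>" _ 1]] e_norm lp_norm_nonneg by force
  have "(\<lambda>n. SUP f\<in>K. ennreal (norm (f (x n)))) \<longlonglongrightarrow> 0" if x: "weakly_p_summable p X x" for x
    unfolding SUP_ennreal_tendsto_0_iff
  proof (intro allI impI)
    fix \<epsilon> :: real assume \<epsilon>: "\<epsilon> > 0"
    obtain T where T: "operator ?L X T" "\<And>n. T (?e n) = x n"
      using operator_of_weakly_p_summable[OF p pq q X x] by blast
    have op: "operator Y X (\<lambda>y. T (\<psi> y))"
      by (rule operator_compose[OF \<psi> T(1)])
    have "\<forall>\<^sub>F n in sequentially. \<forall>f\<in>K. norm (f (T (\<psi> (\<phi> (?e n))))) \<le> \<epsilon>"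
      by (rule relatively_compact_adjoint_imp_uniform[OF Y nX op p0 K(1) rc[OF op]
            weakly_p_summable_image[OF p0 \<phi> e] \<phi>e_norm \<epsilon>])
    then show "\<forall>\<^sub>F n in sequentially. \<forall>f\<in>K. norm (f (x n)) \<le> \<epsilon>"
      using inverse[OF e_L] T(2) by simp
  qed
  then show ?thesis
    using K by (simp add: weakly_p_limited_def)
qed

theorem weakly_p_limited_characterizations:
  fixes X :: "('k::{real_normed_field,heine_borel}, 'x) normed_module" and \<phi> :: "(nat \<Rightarrow> 'k) \<Rightarrow> 'y"
  assumes p: "1 < p" and pq: "1 / p + 1 / q = 1"
    and X: "banach_space X" "has_norming_functionals X"
    and K: "K \<subseteq> carrier (dual_space X)" "norm_bounded (dual_space X) K"
    and \<phi>: "inj \<phi>"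
  shows
    "weakly_p_limited p X K \<longleftrightarrow>
       (\<forall>Y :: ('k, 'y) normed_module. Y \<in> W_class p \<longrightarrow>
          (\<forall>T. operator Y X T \<longrightarrow> relatively_compact (dual_space Y) (adjoint_map Y T ` K)))"
    (is "?limited \<longleftrightarrow> ?all_W")
    "weakly_p_limited p X K \<longleftrightarrow>
       (\<forall>T. operator (lp_space q) X T \<longrightarrow>
          relatively_compact (dual_space (lp_space q)) (adjoint_map (lp_space q) T ` K))"
    (is "_ \<longleftrightarrow> ?all_lp")
proof -
  let ?L = "lp_space q :: ('k, _) normed_module"
  have "0 < 1 / p" "1 / p < 1" using p by auto
  then have "1 / q > 0" "1 / q < 1" using pq by linarith+
  then have q: "1 < q" by (auto simp: field_simps zero_less_divide_iff split: if_splits)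
  have p0: "0 < p" using p by simp
  have nX: "nspace X" using X by (simp add: nspace_def banach_space_def)
  have lp: "?L \<in> W_class p" by (rule lp_in_W_class[OF p pq q])
  interpret isometric_copy ?L \<phi>
    using q \<phi> by (intro isometric_copy.intro nspace_lp isometric_copy_axioms.intro)
      (auto intro: inj_on_subset)
  have "operator ?L ?L (\<lambda>a. a)"
    by (simp add: operator_def)
  then have "?limited" if "?all_lp"
    using that
    by (intro weakly_p_limited_if_all_adjoints_compact[OF p pq q X K V.nspace_axioms]) auto
  then show "?limited \<longleftrightarrow> ?all_lp"
    using weakly_p_limited_imp_relatively_compact[OF nX p _ lp] by blast
  have "?limited" if "?all_W"
    using that W_class_transport[OF p0 lp]
    by (intro weakly_p_limited_if_all_adjoints_compact[OF p pq q X K nspace_transport operator_phi operator_psi])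
      auto
  then show "?limited \<longleftrightarrow> ?all_W"
    using weakly_p_limited_imp_relatively_compact[OF nX p] by blast
qed

text \<open>
  Reals are coded by sets of naturals; a sequence of such sets is a set of pairs.
\<close>

lemma real_sequences_lepoll: "(UNIV :: (nat \<Rightarrow> real) set) \<lesssim> (UNIV :: real set)"
proof -
  obtain g :: "real \<Rightarrow> nat set" where g: "inj g"
    using nat_sets_eqpoll_reals eqpoll_imp_lepoll eqpoll_sym unfolding lepoll_def by blast
  define h where "h = (\<lambda>a :: nat \<Rightarrow> real. {prod_encode (n, m) | n m. m \<in> g (a n)})"
  have mem: "prod_encode (n, m) \<in> h a \<longleftrightarrow> m \<in> g (a n)" for a n m
    by (auto simp: h_def)
  have "inj h"
  proof
    fix a b assume "h a = h b"
    then have "g (a n) = g (b n)" for n using mem by blast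
    then show "a = b" using g by (auto simp: inj_eq)
  qed
  then have "(UNIV :: (nat \<Rightarrow> real) set) \<lesssim> (UNIV :: nat set set)"
    unfolding lepoll_def by auto
  then show ?thesis
    using eqpoll_imp_lepoll[OF nat_sets_eqpoll_reals] by (rule lepoll_trans)
qed

lemma complex_sequences_lepoll: "(UNIV :: (nat \<Rightarrow> complex) set) \<lesssim> (UNIV :: real set)"
proof -
  define h where "h = (\<lambda>(a :: nat \<Rightarrow> complex) n. if even n then Re (a (n div 2)) else Im (a (n div 2)))"
  have "inj h"
  proof
    fix a b assume eq: "h a = h b"
    show "a = b"
    proof
      fix n
      have "h a (2 * n) = h b (2 * n)" "h a (2 * n + 1) = h b (2 * n + 1)" using eq by simp_all
      then show "a n = b n" by (simp add: h_def complex_eq_iff)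
    qed
  qed
  then have "(UNIV :: (nat \<Rightarrow> complex) set) \<lesssim> (UNIV :: (nat \<Rightarrow> real) set)"
    unfolding lepoll_def by auto
  then show ?thesis
    using real_sequences_lepoll by (rule lepoll_trans)
qed

theorem theorem2p5:
  fixes p q :: real
  assumes "1 < p" and "1 / p + 1 / q = 1"
    and "(UNIV :: real set) \<lesssim> (UNIV :: 'y set)"
  shows
   "(\<forall>(X :: (real, 'x) normed_module) K.
       banach_space X \<and> K \<subseteq> carrier (dual_space X) \<and> norm_bounded (dual_space X) K \<longrightarrow>
       (weakly_p_limited p X K \<longleftrightarrow>
          (\<forall>Y :: (real, 'y) normed_module. Y \<in> W_class p \<longrightarrow>
             (\<forall>T. operator Y X T \<longrightarrow> relatively_compact (dual_space Y) (adjoint_map Y T ` K)))) \<and>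
       (weakly_p_limited p X K \<longleftrightarrow>
          (\<forall>T. operator (lp_space q) X T \<longrightarrow>
             relatively_compact (dual_space (lp_space q)) (adjoint_map (lp_space q) T ` K)))) \<and>
    (\<forall>(X :: (complex, 'x) normed_module) K.
       banach_space X \<and> K \<subseteq> carrier (dual_space X) \<and> norm_bounded (dual_space X) K \<longrightarrow>
       (weakly_p_limited p X K \<longleftrightarrow>
          (\<forall>Y :: (complex, 'y) normed_module. Y \<in> W_class p \<longrightarrow>
             (\<forall>T. operator Y X T \<longrightarrow> relatively_compact (dual_space Y) (adjoint_map Y T ` K)))) \<and>
       (weakly_p_limited p X K \<longleftrightarrow>
          (\<forall>T. operator (lp_space q) X T \<longrightarrow>
             relatively_compact (dual_space (lp_space q)) (adjoint_map (lp_space q) T ` K))))"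
proof -
  obtain \<phi>_real :: "(nat \<Rightarrow> real) \<Rightarrow> 'y" where \<phi>_real: "inj \<phi>_real"
    using lepoll_trans[OF real_sequences_lepoll assms(3)] by (auto simp: lepoll_def)
  obtain \<phi>_complex :: "(nat \<Rightarrow> complex) \<Rightarrow> 'y" where \<phi>_complex: "inj \<phi>_complex"
    using lepoll_trans[OF complex_sequences_lepoll assms(3)] by (auto simp: lepoll_def)
  have norming_real: "has_norming_functionals X" if "banach_space X" for X :: "(real, 'x) normed_module"
    using that by (intro norming_functionals_real) (simp add: nspace_def banach_space_def)
  have norming_complex: "has_norming_functionals X" if "banach_space X" for X :: "(complex, 'x) normed_module"
    using that by (intro norming_functionals_complex) (simp add: nspace_def banach_space_def)
  note real = weakly_p_limited_characterizations[OF assms(1,2) _ norming_real _ _ \<phi>_real]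
  note complex = weakly_p_limited_characterizations[OF assms(1,2) _ norming_complex _ _ \<phi>_complex]
  show ?thesis
    by (intro conjI allI impI; elim conjE; rule real complex; assumption)
qed

end
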